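(* Let $n\geq 2$ be an even integer and $p>0$. Let $u$ be a radially symmetric continuous function on $\mathbb{R}^n$ with $(1+|x|^{np})e^{nu}\in L^1(\mathbb{R}^n)$ satisfying, for some constant $C\in\mathbb{R}$ and all $x\in\mathbb{R}^n$, $$u(x)=\frac{2}{(n-1)!\,|\mathbb{S}^n|}\int_{\mathbb{R}^n}\log\frac{|y|}{|x-y|}\,(1+|y|^{np})e^{nu(y)}\,dy+C,$$ and set $$\beta:=\frac{2}{(n-1)!\,|\mathbb{S}^n|}\int_{\mathbb{R}^n}(1+|x|^{np})e^{nu}\,dx.$$ Then $$\max\{2,2p\}<\beta<2+2p.$$
   Context: $|\mathbb{S}^n|$ denotes the volume of the standard unit $n$-sphere. Radially symmetric means depending only on $|x|$. *)

theory Defs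
  imports "HOL-Analysis.Analysis"
begin

text \<open>
  Surface measure on the unit sphere of a Euclidean space of dimension \<open>d\<close>, defined as in the
  theory of polar coordinates: \<open>d\<close> times the Lebesgue measure of the (punctured) cone of height
  one over the given subset of the sphere.
\<close>

definition sphere_measure :: "'a::euclidean_space set \<Rightarrow> real" where
  "sphere_measure E =
     real DIM('a) * measure lebesgue {r *\<^sub>R x |r x. 0 < r \<and> r \<le> 1 \<and> x \<in> E}"

text \<open>
  The unit sphere \<open>S\<^sup>n\<close> lives in \<open>\<real>\<^sup>n\<^sup>+\<^sup>1\<close>, realised as \<open>\<real>\<^sup>n \<times> \<real>\<close>; the product norm is the
  Euclidean one.
\<close>

definition sphere_volume :: "'n::finite itself \<Rightarrow> real" where
  "sphere_volume _ = sphere_measure (sphere 0 1 :: ((real ^ 'n) \<times> real) set)"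

definition radially_symmetric :: "('a::real_normed_vector \<Rightarrow> 'b) \<Rightarrow> bool" where
  "radially_symmetric f \<longleftrightarrow> (\<forall>x y. norm x = norm y \<longrightarrow> f x = f y)"

lemma sphere_measure_unit_sphere:
  "sphere_measure (sphere 0 1 :: 'a::euclidean_space set)
     = real DIM('a) * unit_ball_vol (real DIM('a))"
proof -
  have "{r *\<^sub>R x |r x. 0 < r \<and> r \<le> 1 \<and> x \<in> sphere (0::'a) 1} = cball 0 1 - {0}"
  proof (intro equalityI subsetI)
    fix z :: 'a assume z: "z \<in> cball 0 1 - {0}"
    then have "z = norm z *\<^sub>R (z /\<^sub>R norm z)" "z /\<^sub>R norm z \<in> sphere 0 1"
      by auto
    with z show "z \<in> {r *\<^sub>R x |r x. 0 < r \<and> r \<le> 1 \<and> x \<in> sphere (0::'a) 1}"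
      by (intro CollectI exI[of _ "norm z"] exI[of _ "z /\<^sub>R norm z"]) auto
  qed auto
  moreover have "measure lebesgue (cball (0::'a) 1 - {0}) = measure lebesgue (cball (0::'a) 1)"
    by (rule measure_Diff_null_set) auto
  ultimately show ?thesis
    by (simp add: sphere_measure_def content_cball)
qed

lemma sphere_volume_eq:
  "sphere_volume TYPE('n::finite)
     = 2 * pi powr ((real CARD('n) + 1) / 2) / Gamma ((real CARD('n) + 1) / 2)"
proof -
  define a where "a = (real CARD('n) + 1) / 2"
  have a: "a > 0" by (simp add: a_def add_pos_nonneg)
  have "sphere_volume TYPE('n) = 2 * a * (pi powr a / Gamma (a + 1))"
  proof -
    have "real DIM((real ^ 'n) \<times> real) = 2 * a"
      by (simp add: a_def)
    then show ?thesis
      unfolding sphere_volume_def sphere_measure_unit_sphere unit_ball_vol_def by simp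
  qed
  also have "Gamma (a + 1) = a * Gamma a"
    using a by (intro Gamma_plus1) (auto elim!: nonpos_Ints_cases)
  finally show ?thesis
    using a unfolding a_def [symmetric] by simp
qed

end

theory Submission
  imports Defs "HOL-Complex_Analysis.Cauchy_Integral_Formula"
begin

text \<open>
  Write \<open>\<mu>\<^sub>0\<close> and \<open>\<mu>\<^sub>1\<close> for the measures with densities \<open>c e\<^sup>n\<^sup>u\<close> and \<open>c |x|\<^sup>n\<^sup>p e\<^sup>n\<^sup>u\<close>, \<open>\<beta>\<^sub>0\<close> and
  \<open>\<beta>\<^sub>1\<close> for their masses, and \<open>V\<^sub>\<mu>\<close> for the logarithmic potential of \<open>\<mu>\<close>, so that
  \<open>u = C - V\<^sub>\<mu>\<close> with \<open>\<mu> = \<mu>\<^sub>0 + \<mu>\<^sub>1\<close>. Averaging the kernel over the rotations of a plane shows that,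
  for radial \<open>\<mu>\<close>, the function \<open>h \<mapsto> V\<^sub>\<mu> (e\<^sup>h x)\<close> is nondecreasing and Lipschitz with constant
  \<open>\<mu> (\<real>\<^sup>n)\<close>; let \<open>V'\<^sub>\<mu>\<close> be its derivative at \<open>0\<close>. Symmetrising the kernel gives
  \<open>\<integral> V'\<^sub>\<mu> d\<mu> = \<mu> (\<real>\<^sup>n)\<^sup>2 / 2\<close>. On the other hand \<open>e\<^sup>-\<^sup>z \<ge> 1 - z\<close> and the scaling of the Lebesgue measure
  give \<open>e\<^sup>-\<^sup>n\<^sup>h \<beta>\<^sub>0 \<ge> \<beta>\<^sub>0 - n \<integral> (V\<^sub>\<mu> (e\<^sup>h x) - V\<^sub>\<mu> x) d\<mu>\<^sub>0\<close> for all \<open>h\<close> of either sign, with equality at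
  \<open>h = 0\<close>; hence the derivatives agree there, \<open>\<integral> V'\<^sub>\<mu> d\<mu>\<^sub>0 = \<beta>\<^sub>0\<close>, and likewise
  \<open>\<integral> V'\<^sub>\<mu> d\<mu>\<^sub>1 = (1 + p) \<beta>\<^sub>1\<close>. No boundary terms at infinity arise.

  The sum of the two is the Pohozaev identity \<open>\<beta>\<^sup>2 / 2 = \<beta> + p \<beta>\<^sub>1\<close>, which gives
  \<open>2 < \<beta> < 2 + 2 p\<close>. The first one alone gives
  \<open>\<beta>\<^sub>0 = \<beta>\<^sub>0\<^sup>2 / 2 + \<integral> V'\<^sub>\<mu>\<^sub>1 d\<mu>\<^sub>0 > \<beta>\<^sub>0\<^sup>2 / 2\<close>, that is \<open>\<beta>\<^sub>0 < 2\<close>, which by the Pohozaev identity means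
  \<open>(\<beta> - 2) (\<beta> - 2 p) > 0\<close>.
\<close>

section \<open>Lebesgue integrals\<close>

text \<open>By the Vitali covering theorem, \<open>U\<close> is a disjoint union of balls up to a null set.\<close>

lemma emeasure_orthogonal_image_open_le:
  fixes T :: "'a::euclidean_space \<Rightarrow> 'a"
  assumes T: "orthogonal_transformation T" and "open U"
  shows "emeasure lborel (T ` U) \<le> emeasure lborel U"
proof -
  define K where "K = {(a, r). ball a r \<subseteq> U}"
  have cover: "\<exists>i. i \<in> K \<and> x \<in> ball (fst i) (snd i) \<and> snd i < d" if "x \<in> U" "0 < d" for x d
  proof -
    obtain e where e: "e > 0" "ball x e \<subseteq> U"
      using \<open>open U\<close> \<open>x \<in> U\<close> open_contains_ball by blast
    have "ball x (min e (d/2)) \<subseteq> U"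
      using e by auto
    then show ?thesis
      using e that by (intro exI[of _ "(x, min e (d/2))"]) (auto simp: K_def)
  qed
  obtain C where C: "countable C" "C \<subseteq> K"
     "pairwise (\<lambda>i j. disjnt (ball (fst i) (snd i)) (ball (fst j) (snd j))) C"
     "negligible (U - (\<Union>i\<in>C. ball (fst i) (snd i)))"
    by (rule Vitali_covering_theorem_balls[of U K fst snd, OF cover])
  let ?B = "\<lambda>i. ball (fst i) (snd i)"
  let ?N = "U - (\<Union>i\<in>C. ?B i)"
  have CU: "(\<Union>i\<in>C. ?B i) \<subseteq> U"
  proof (rule UN_least)
    fix i assume "i \<in> C"
    then have "i \<in> K" using C(2) by blast
    then show "?B i \<subseteq> U" by (simp add: K_def case_prod_unfold)
  qed
  have TU: "T ` U = (\<Union>i\<in>C. T ` ?B i) \<union> T ` ?N"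
    unfolding image_UN[symmetric] image_Un[symmetric] using CU by (simp add: Un_absorb1)
  have TB: "T ` ?B i = ball (T (fst i)) (snd i)" for i
    by (rule image_orthogonal_transformation_ball[OF T])
  have "open (\<Union>i\<in>C. T ` ?B i)"
    unfolding TB by (intro open_UN ballI open_ball)
  then have BT: "(\<Union>i\<in>C. T ` ?B i) \<in> sets lborel"
    by (simp only: sets_lborel borel_open)
  have lin: "linear T" using T orthogonal_transformation_linear by blast
  have "open (T ` U)"
    using T \<open>open U\<close> by (simp add: lin open_surjective_linear_image orthogonal_transformation_surj)
  \<comment> \<open>Linear maps are differentiable and so send null sets to null sets. The part of
    \<open>U\<close> missed by the balls therefore stays null under \<open>T\<close>, and only the
    balls, whose radii \<open>T\<close> preserves, have to be compared.\<close>
  have "negligible (T ` ?N)"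
    using C(4) lin by (intro negligible_differentiable_image_negligible)
      (auto intro: linear_imp_differentiable_on)
  moreover have "T ` ?N \<in> sets lborel"
  proof -
    have "T ` ?N = T ` U - (\<Union>i\<in>C. T ` ?B i)"
      by (simp only: image_set_diff[OF orthogonal_transformation_inj[OF T]] image_UN)
    moreover have "T ` U \<in> sets lborel"
      using \<open>open (T ` U)\<close> by (simp only: sets_lborel borel_open)
    ultimately show ?thesis
      using BT by (simp only: sets.Diff)
  qed
  ultimately have N: "T ` ?N \<in> null_sets lborel"
    by (simp add: negligible_iff_null_sets null_sets_completion_iff)
  have disj: "disjoint_family_on ?B C"
    using C(3) by (auto simp: disjoint_family_on_def pairwise_def disjnt_def)
  have disj': "disjoint_family_on (\<lambda>i. T ` ?B i) C"
    unfolding disjoint_family_on_def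
  proof (intro ballI impI)
    fix i j assume "i \<in> C" "j \<in> C" "i \<noteq> j"
    then have "?B i \<inter> ?B j = {}"
      using disj by (auto simp: disjoint_family_on_def)
    then show "T ` ?B i \<inter> T ` ?B j = {}"
      by (metis T image_Int image_empty orthogonal_transformation_inj)
  qed
  have eq: "emeasure lborel (T ` ?B i) = emeasure lborel (?B i)" for i
    by (cases "snd i \<ge> 0") (simp_all add: TB emeasure_ball ball_empty)
  have "emeasure lborel (T ` U) \<le> emeasure lborel (\<Union>i\<in>C. T ` ?B i) + 0"
    unfolding TU using N BT by (simp only: emeasure_Un_null_set add_0_right order_refl)
  also have "emeasure lborel (\<Union>i\<in>C. T ` ?B i) = (\<integral>\<^sup>+i. emeasure lborel (T ` ?B i) \<partial>count_space C)"
    using disj' C(1) by (intro emeasure_UN_countable) (simp_all add: TB)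
  also have "\<dots> = (\<integral>\<^sup>+i. emeasure lborel (?B i) \<partial>count_space C)"
    by (simp only: eq)
  also have "\<dots> = emeasure lborel (\<Union>i\<in>C. ?B i)"
    using disj C(1) by (intro emeasure_UN_countable[symmetric]) auto
  also have "\<dots> \<le> emeasure lborel U"
    using CU \<open>open U\<close> by (intro emeasure_mono) auto
  finally show ?thesis by simp
qed

text \<open>The preceding inequality, used for \<open>T\<close> and for its inverse, becomes an
  equality on preimages of boxes, and values on boxes determine Lebesgue measure.\<close>

lemma lborel_distr_orthogonal:
  fixes T :: "'a::euclidean_space \<Rightarrow> 'a"
  assumes T: "orthogonal_transformation T"
  shows "distr lborel borel T = lborel"
proof (rule lborel_eqI[symmetric])
  fix l u :: 'a
  assume lu: "\<And>b. b \<in> Basis \<Longrightarrow> l \<bullet> b \<le> u \<bullet> b"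
  have lin: "linear T" using T orthogonal_transformation_linear by blast
  have [measurable]: "T \<in> borel_measurable borel"
    using lin by (intro borel_measurable_continuous_onI linear_continuous_on) (simp add: linear_linear)
  let ?S = "inv T"
  have S: "orthogonal_transformation ?S" by (rule orthogonal_transformation_inv[OF T])
  have bij: "bij T" by (rule orthogonal_transformation_bij[OF T])
  have vim: "T -` box l u = ?S ` box l u"
    using bij by (rule bij_vimage_eq_inv_image)
  have op: "open (?S ` box l u)"
    unfolding vim[symmetric] using lin
    by (intro open_vimage) (auto intro!: linear_continuous_on simp: linear_linear)
  have "emeasure lborel (T ` ?S ` box l u) \<le> emeasure lborel (?S ` box l u)"
    using emeasure_orthogonal_image_open_le[OF T op] .
  moreover have "T ` ?S ` box l u = box l u"
    using bij by (simp add: bij_is_surj image_f_inv_f)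
  ultimately have "emeasure lborel (?S ` box l u) = emeasure lborel (box l u)"
    using emeasure_orthogonal_image_open_le[OF S open_box, of l u] by (intro antisym) simp_all
  then have "emeasure (distr lborel borel T) (box l u) = emeasure lborel (box l u)"
    by (simp add: emeasure_distr vim)
  also have "\<dots> = (\<Prod>b\<in>Basis. (u - l) \<bullet> b)"
    using lu by (simp add: emeasure_lborel_box_eq)
  finally show "emeasure (distr lborel borel T) (box l u) = (\<Prod>b\<in>Basis. (u - l) \<bullet> b)" .
qed simp

lemma
  fixes T :: "'a::euclidean_space \<Rightarrow> 'a" and h :: "'a \<Rightarrow> real"
  assumes T: "orthogonal_transformation T" and [measurable]: "h \<in> borel_measurable borel"
  shows lborel_integral_orthogonal: "(\<integral>x. h (T x) \<partial>lborel) = (\<integral>x. h x \<partial>lborel)"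
    and lborel_integrable_orthogonal: "integrable lborel (\<lambda>x. h (T x)) \<longleftrightarrow> integrable lborel h"
proof -
  have [measurable]: "T \<in> borel_measurable borel"
    using orthogonal_transformation_linear[OF T]
    by (intro borel_measurable_continuous_onI linear_continuous_on) (simp add: linear_linear)
  show "(\<integral>x. h (T x) \<partial>lborel) = (\<integral>x. h x \<partial>lborel)"
    using integral_distr[of T lborel borel h] by (simp add: lborel_distr_orthogonal[OF T])
  show "integrable lborel (\<lambda>x. h (T x)) \<longleftrightarrow> integrable lborel h"
    using integrable_distr_eq[of T lborel borel h] by (simp add: lborel_distr_orthogonal[OF T])
qed

lemma lborel_integral_scaleR:
  fixes h :: "'a::euclidean_space \<Rightarrow> real"
  assumes "c > 0" and [measurable]: "h \<in> borel_measurable borel"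
  shows "(\<integral>x. h (c *\<^sub>R x) \<partial>lborel) = (\<integral>x. h x \<partial>lborel) / c ^ DIM('a)"
proof -
  have "(\<integral>x. h x \<partial>lborel) = (\<integral>x. h x \<partial>density (distr lborel borel (\<lambda>x. 0 + c *\<^sub>R x)) (\<lambda>_. \<bar>c\<bar> ^ DIM('a)))"
    using assms by (subst lborel_affine[of c 0]) auto
  also have "\<dots> = c ^ DIM('a) * (\<integral>x. h (c *\<^sub>R x) \<partial>lborel)"
    using assms by (subst integral_density) (auto simp: integral_distr)
  finally show ?thesis
    using assms by (simp add: field_simps)
qed

text \<open>The bound forces \<open>q 0 = 0\<close> and says that the difference quotients at
  \<open>0\<close> are dominated by \<open>w\<close>, so dominated convergence applies.
  Differentiability is asked only almost everywhere, because the averaged kernel below is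
  differentiated only off the sphere \<open>norm y = norm x\<close>.\<close>

lemma has_derivative_integral_at_0:
  fixes q :: "real \<Rightarrow> 'a \<Rightarrow> real"
  assumes meas [measurable]: "\<And>h. q h \<in> borel_measurable M" "q' \<in> borel_measurable M"
    and bound: "\<And>h y. y \<in> space M \<Longrightarrow> \<bar>q h y\<bar> \<le> \<bar>h\<bar> * w y"
    and w: "integrable M w"
    and deriv: "AE y in M. ((\<lambda>h. q h y) has_real_derivative q' y) (at 0)"
  shows "((\<lambda>h. \<integral>y. q h y \<partial>M) has_real_derivative (\<integral>y. q' y \<partial>M)) (at 0)"
proof -
  have q0: "q 0 y = 0" if "y \<in> space M" for y
    using bound[OF that, of 0] by simp
  have int: "integrable M (q h)" for h
  proof (rule Bochner_Integration.integrable_bound)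
    show "integrable M (\<lambda>y. \<bar>h\<bar> * w y)" using w by simp
    show "AE y in M. norm (q h y) \<le> norm (\<bar>h\<bar> * w y)"
    proof (rule AE_I2)
      fix y assume "y \<in> space M"
      then have "\<bar>q h y\<bar> \<le> \<bar>h\<bar> * w y" by (rule bound)
      also have "\<dots> \<le> \<bar>\<bar>h\<bar> * w y\<bar>" by (rule abs_ge_self)
      finally show "norm (q h y) \<le> norm (\<bar>h\<bar> * w y)" by (simp only: real_norm_def)
    qed
  qed (rule meas)
  have "(\<lambda>h. ((\<integral>y. q (0 + h) y \<partial>M) - (\<integral>y. q 0 y \<partial>M)) / h) \<midarrow>0\<rightarrow> (\<integral>y. q' y \<partial>M)"
    unfolding tendsto_at_iff_sequentially comp_def
  proof (intro allI impI)
    fix X :: "nat \<Rightarrow> real"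
    assume X: "\<forall>i. X i \<in> UNIV - {0}" "X \<longlonglongrightarrow> 0"
    have "(\<lambda>i. \<integral>y. q (X i) y / X i \<partial>M) \<longlonglongrightarrow> (\<integral>y. q' y \<partial>M)"
    proof (rule integral_dominated_convergence)
      show "AE y in M. (\<lambda>i. q (X i) y / X i) \<longlonglongrightarrow> q' y"
        using deriv AE_space
      proof eventually_elim
        case (elim y)
        then have "((\<lambda>h. q h y / h) \<longlongrightarrow> q' y) (at 0)"
          by (simp add: has_field_derivative_iff q0)
        then show ?case
          using X unfolding tendsto_at_iff_sequentially comp_def by blast
      qed
      show "AE y in M. norm (q (X i) y / X i) \<le> w y" for i
      proof (rule AE_I2)
        fix y assume y: "y \<in> space M"
        have "0 < \<bar>X i\<bar>" using X(1) by auto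
        then show "norm (q (X i) y / X i) \<le> w y"
          using bound[OF y, of "X i"] by (simp add: abs_divide pos_divide_le_eq mult.commute)
      qed
    qed (use w in simp_all)
    moreover have "(\<integral>y. q (X i) y / X i \<partial>M) = ((\<integral>y. q (0 + X i) y \<partial>M) - (\<integral>y. q 0 y \<partial>M)) / X i" for i
    proof -
      have "(\<integral>y. q 0 y \<partial>M) = (\<integral>y. 0 \<partial>M)"
        using q0 by (intro Bochner_Integration.integral_cong) auto
      then show ?thesis using int[of "X i"] by simp
    qed
    ultimately show "(\<lambda>i. ((\<integral>y. q (0 + X i) y \<partial>M) - (\<integral>y. q 0 y \<partial>M)) / X i) \<longlonglongrightarrow> (\<integral>y. q' y \<partial>M)"
      by (simp only:)
  qed
  then show ?thesis by (simp only: DERIV_def)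
qed

section \<open>Integrability of the logarithmic kernel\<close>

text \<open>The negative part of the logarithm, which carries its singularity. Since
  \<open>ln 0 = 0\<close>, the value at the origin is \<open>0\<close>.\<close>

definition neg_ln :: "'a::real_normed_vector \<Rightarrow> real" where
  "neg_ln z = max 0 (- ln (norm z))"

lemma neg_ln_nonneg [simp]: "0 \<le> neg_ln z"
  by (simp add: neg_ln_def)

lemma borel_measurable_neg_ln [measurable]:
  "(neg_ln :: 'a::euclidean_space \<Rightarrow> real) \<in> borel_measurable borel"
  unfolding neg_ln_def[abs_def] by measurable

lemma neg_ln_eq_0: "1 \<le> norm z \<Longrightarrow> neg_ln z = 0"
  by (simp add: neg_ln_def)

text \<open>The value at \<open>z\<close> is at most the number of \<open>k\<close> with
  \<open>norm z < exp (- k)\<close>. Summing over \<open>k\<close> turns the integral into a series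
  of ball volumes, which is geometric.\<close>

lemma integrable_neg_ln: "integrable lborel (neg_ln :: 'a::euclidean_space \<Rightarrow> real)"
proof (rule integrableI_bounded)
  let ?B = "\<lambda>k::nat. ball (0::'a) (exp (- real k))"
  have le: "ennreal (norm (neg_ln z)) \<le> (\<Sum>k. indicator (?B k) z)" for z :: 'a
  proof (cases "z = 0 \<or> 1 \<le> norm z")
    case False
    define m where "m = nat \<lceil>- ln (norm z)\<rceil>"
    have m: "neg_ln z \<le> real m"
      unfolding neg_ln_def m_def by linarith
    have "norm z < exp (- real k)" if "k < m" for k
    proof -
      have "real k < - ln (norm z)"
        using that unfolding m_def by linarith
      then have "ln (norm z) < - real k" by simp
      then show ?thesis
        using False by (metis exp_less_mono exp_ln zero_less_norm_iff)
    qed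
    then have "(\<Sum>k<m. indicator (?B k) z :: ennreal) = (\<Sum>k<m. 1)"
      by (intro sum.cong) (auto simp: indicator_def)
    then have "ennreal (real m) \<le> (\<Sum>k<m. indicator (?B k) z :: ennreal)"
      by (simp add: ennreal_of_nat_eq_real_of_nat)
    also have "\<dots> \<le> (\<Sum>k. indicator (?B k) z)"
      by (rule sum_le_suminf) auto
    finally have "ennreal (real m) \<le> (\<Sum>k. indicator (?B k) z)" .
    then show ?thesis
      using order_trans[OF ennreal_leI[OF m]] by simp
  qed (auto simp: neg_ln_def)
  let ?V = "unit_ball_vol (real DIM('a))"
  have "(\<integral>\<^sup>+z. ennreal (norm (neg_ln (z::'a))) \<partial>lborel) \<le> (\<integral>\<^sup>+z. (\<Sum>k. indicator (?B k) z) \<partial>lborel)"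
    by (intro nn_integral_mono le)
  also have "\<dots> = (\<Sum>k. emeasure lborel (?B k))"
    by (subst nn_integral_suminf) (auto intro!: borel_measurable_indicator)
  also have "\<dots> = (\<Sum>k. ennreal (?V * exp (- real DIM('a)) ^ k))"
    by (simp add: emeasure_ball exp_of_nat_mult[symmetric] mult.commute)
  also have "\<dots> < \<infinity>"
    unfolding infinity_ennreal_def less_top[symmetric]
    by (intro ennreal_suminf_neq_top summable_mult summable_geometric) auto
  finally show "(\<integral>\<^sup>+z. ennreal (norm (neg_ln (z::'a))) \<partial>lborel) < \<infinity>" .
qed simp

text \<open>If \<open>norm (y - b)\<close> is at least \<open>1\<close>, the triangle inequality
  bounds the ratio of the two distances by \<open>1 + norm (a - b)\<close>. Otherwise it bounds
  \<open>norm (y - a)\<close> by the same number, and \<open>neg_ln (y - b)\<close> pays for the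
  other logarithm.\<close>

lemma abs_ln_norm_diff_le:
  fixes y a b :: "'a::real_normed_vector"
  shows "\<bar>ln (norm (y - a)) - ln (norm (y - b))\<bar> \<le> norm (a - b) + neg_ln (y - a) + neg_ln (y - b)"
proof -
  have ln_le: "ln t \<le> t" if "0 \<le> t" for t :: real
    using that ln_le_minus_one[of t] by (cases "t = 0") auto
  have *: "ln (norm (y - a)) \<le> ln (norm (y - b)) + norm (a - b) + neg_ln (y - b)" for a b :: 'a
  proof -
    let ?d = "norm (a - b)"
    \<comment> \<open>The coincidences \<open>y = a\<close> and \<open>y = b\<close> are separated
      because \<open>ln 0 = 0\<close> there.\<close>
    consider "y = a" | "y = b" | "y \<noteq> a" "y \<noteq> b" "1 \<le> norm (y - b)" | "y \<noteq> a" "y \<noteq> b" "norm (y - b) < 1"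
      by linarith
    then show ?thesis
    proof cases
      case 1
      have "- ln (norm (y - b)) \<le> neg_ln (y - b)" "ln (norm (y - a)) = 0"
        using 1 by (auto simp: neg_ln_def)
      then show ?thesis using norm_ge_zero[of "a - b"] by linarith
    next
      case 2
      then show ?thesis using ln_le[of ?d] by (simp add: neg_ln_def norm_minus_commute)
    next
      case 3
      have "norm (y - a) \<le> norm (y - b) + ?d"
        by (metis norm_diff_triangle_le norm_minus_commute order_refl)
      also have "\<dots> \<le> norm (y - b) + norm (y - b) * ?d"
        using mult_right_mono[OF 3(3), of ?d] by simp
      also have "\<dots> = norm (y - b) * (1 + ?d)" by (simp add: algebra_simps)
      finally have "ln (norm (y - a)) \<le> ln (norm (y - b) * (1 + ?d))"
        using 3 by (subst ln_le_cancel_iff) (auto intro!: mult_pos_pos add_pos_nonneg)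
      also have "\<dots> = ln (norm (y - b)) + ln (1 + ?d)"
        using 3 by (intro ln_mult_pos) (auto intro: add_pos_nonneg)
      also have "ln (1 + ?d) \<le> ?d" by (rule ln_add_one_self_le_self) auto
      finally show ?thesis by (simp add: add_increasing2)
    next
      case 4
      have "norm (y - a) \<le> norm (y - b) + ?d"
        by (metis norm_diff_triangle_le norm_minus_commute order_refl)
      also have "\<dots> \<le> 1 + ?d" using 4 by simp
      finally have "ln (norm (y - a)) \<le> ln (1 + ?d)"
        using 4 by (subst ln_le_cancel_iff) (auto intro!: add_pos_nonneg)
      also have "\<dots> \<le> ?d" by (rule ln_add_one_self_le_self) auto
      finally show ?thesis using 4 by (simp add: neg_ln_def)
    qed
  qed
  show ?thesis
    using *[of a b] *[of b a] neg_ln_nonneg[of "y - a"] neg_ln_nonneg[of "y - b"]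
      norm_minus_commute[of a b] by linarith
qed

lemma
  fixes c :: "'a::euclidean_space"
  shows integrable_neg_ln_diff: "integrable lborel (\<lambda>y. neg_ln (y - c))"
    and integral_neg_ln_diff: "(\<integral>y. neg_ln (y - c) \<partial>lborel) = (\<integral>y. neg_ln (y::'a) \<partial>lborel)"
proof -
  have "integrable (distr lborel borel ((+) (- c))) (neg_ln :: 'a \<Rightarrow> real)"
    by (simp add: lborel_distr_plus integrable_neg_ln)
  then show "integrable lborel (\<lambda>y. neg_ln (y - c))"
    by (subst (asm) integrable_distr_eq) auto
  have "(\<integral>y. neg_ln (y::'a) \<partial>lborel) = (\<integral>y. neg_ln y \<partial>distr lborel borel ((+) (- c)))"
    by (simp add: lborel_distr_plus)
  also have "\<dots> = (\<integral>y. neg_ln (y - c) \<partial>lborel)"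
    by (subst integral_distr) auto
  finally show "(\<integral>y. neg_ln (y - c) \<partial>lborel) = (\<integral>y. neg_ln (y::'a) \<partial>lborel)" ..
qed

text \<open>The singularities at \<open>a\<close> and \<open>b\<close> are integrable because
  \<open>f\<close> is locally bounded; the rest of the kernel is bounded, so integrability of
  \<open>f\<close> suffices there.\<close>

lemma integrable_ln_norm_diff:
  fixes f :: "'a::euclidean_space \<Rightarrow> real"
  assumes f: "integrable lborel f" and bd: "\<And>R. \<exists>M. \<forall>y. norm y \<le> R \<longrightarrow> \<bar>f y\<bar> \<le> M"
  shows "integrable lborel (\<lambda>y. (ln (norm (y - a)) - ln (norm (y - b))) * f y)"
proof -
  have [measurable]: "f \<in> borel_measurable borel"
    using borel_measurable_integrable[OF f] by simp
  have neg: "integrable lborel (\<lambda>y. neg_ln (y - c) * \<bar>f y\<bar>)" for c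
  proof -
    obtain M where M: "\<And>y. norm y \<le> norm c + 1 \<Longrightarrow> \<bar>f y\<bar> \<le> M"
      using bd by meson
    show ?thesis
    proof (rule Bochner_Integration.integrable_bound)
      show "integrable lborel (\<lambda>y. M * neg_ln (y - c))" by (intro integrable_mult_right integrable_neg_ln_diff)
      show "AE y in lborel. norm (neg_ln (y - c) * \<bar>f y\<bar>) \<le> norm (M * neg_ln (y - c))"
      proof (rule AE_I2)
        fix y
        show "norm (neg_ln (y - c) * \<bar>f y\<bar>) \<le> norm (M * neg_ln (y - c))"
        proof (cases "1 \<le> norm (y - c)")
          case False
          then have "norm y \<le> norm c + 1"
            using norm_triangle_ineq2[of y c] by linarith
          then have "\<bar>f y\<bar> \<le> M" by (rule M)
          then have "\<bar>f y\<bar> \<le> \<bar>M\<bar>" by linarith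
          from mult_right_mono[OF this neg_ln_nonneg[of "y - c"]]
          show ?thesis by (simp add: abs_mult mult.commute)
        qed (simp add: neg_ln_eq_0)
      qed
    qed measurable
  qed
  have "integrable lborel (\<lambda>y. norm (a - b) * \<bar>f y\<bar> + neg_ln (y - a) * \<bar>f y\<bar> + neg_ln (y - b) * \<bar>f y\<bar>)"
    using f neg by (intro Bochner_Integration.integrable_add integrable_mult_right integrable_abs)
  then show ?thesis
  proof (rule Bochner_Integration.integrable_bound)
    show "AE y in lborel. norm ((ln (norm (y - a)) - ln (norm (y - b))) * f y) \<le>
       norm (norm (a - b) * \<bar>f y\<bar> + neg_ln (y - a) * \<bar>f y\<bar> + neg_ln (y - b) * \<bar>f y\<bar>)"
    proof (rule AE_I2)
      fix y
      have "norm ((ln (norm (y - a)) - ln (norm (y - b))) * f y)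
         \<le> (norm (a - b) + neg_ln (y - a) + neg_ln (y - b)) * \<bar>f y\<bar>"
        unfolding real_norm_def abs_mult by (intro mult_right_mono abs_ln_norm_diff_le) simp
      also have "\<dots> \<le> norm (norm (a - b) * \<bar>f y\<bar> + neg_ln (y - a) * \<bar>f y\<bar> + neg_ln (y - b) * \<bar>f y\<bar>)"
        unfolding distrib_right real_norm_def by (rule abs_ge_self)
      finally show "norm ((ln (norm (y - a)) - ln (norm (y - b))) * f y) \<le>
       norm (norm (a - b) * \<bar>f y\<bar> + neg_ln (y - a) * \<bar>f y\<bar> + neg_ln (y - b) * \<bar>f y\<bar>)" .
    qed
  qed measurable
qed

lemma AE_norm_neq: "AE y in lborel. norm (y :: 'a::euclidean_space) \<noteq> r"
proof -
  have "sphere (0::'a) r \<in> null_sets lborel"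
    using negligible_sphere[of "0::'a" r] by (simp add: negligible_iff_null_sets null_sets_completion_iff)
  then show ?thesis
    by (rule AE_I') auto
qed

section \<open>Circular means of the logarithmic kernel\<close>

text \<open>This is the mean value property of the real part of \<open>Ln (1 - q * z)\<close>, which
  is holomorphic on the closed disc and vanishes at \<open>0\<close>. It follows from the Cauchy
  integral formula on the unit circle.\<close>

lemma circle_mean_ln_norm:
  fixes q :: complex
  assumes "norm q < 1"
  shows "((\<lambda>t. ln (norm (1 - q * cis t))) has_integral 0) {0..2*pi}"
proof -
  let ?f = "\<lambda>z. Ln (1 - q * z)"
  have pos: "1 - q * z \<notin> \<real>\<^sub>\<le>\<^sub>0" if "z \<in> cball 0 1" for z
  proof -
    have "norm (q * z) < 1"
      using that assms by (simp add: norm_mult) (metis mult.right_neutral mult_left_mono norm_ge_zero order_le_less_trans)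
    then have "Re (q * z) < 1"
      using complex_Re_le_cmod order_le_less_trans by blast
    then show ?thesis
      by (auto simp: complex_nonpos_Reals_iff)
  qed
  have "?f holomorphic_on cball 0 1"
    using pos by (intro holomorphic_intros) auto
  then have "((\<lambda>u. ?f u / (u - 0)) has_contour_integral (2 * of_real pi * \<i> * ?f 0)) (circlepath 0 1)"
    by (intro Cauchy_integral_circlepath_simple) auto
  then have "((\<lambda>t. ?f (cis t) / cis t * \<i> * cis t) has_integral 0) {0..2*pi}"
    unfolding circlepath_def by (subst (asm) has_contour_integral_part_circlepath_iff) auto
  then have "((\<lambda>t. ?f (cis t) * \<i>) has_integral 0) {0..2*pi}"
    by (simp add: field_simps)
  \<comment> \<open>Multiplication by \<open>\<i>\<close> moves the real part of the logarithm into
    the imaginary part.\<close>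
  then have "((\<lambda>t. Im (?f (cis t) * \<i>)) has_integral Im 0) {0..2*pi}"
    by (rule has_integral_linear[OF _ bounded_linear_Im, unfolded o_def])
  moreover have "Im (?f (cis t) * \<i>) = ln (norm (1 - q * cis t))" for t
  proof -
    have "1 - q * cis t \<notin> \<real>\<^sub>\<le>\<^sub>0" by (rule pos) auto
    then have "1 - q * cis t \<noteq> 0" by auto
    then show ?thesis by simp
  qed
  ultimately show ?thesis by simp
qed

text \<open>
  The larger root \<open>t\<close> of \<open>t\<^sup>2 - (r\<^sup>2 + s\<^sup>2) t + r\<^sup>2 k = 0\<close>. If \<open>|x| = r\<close>, \<open>|y| = s\<close> and \<open>k\<close> is the squared
  norm of the projection of \<open>y\<close> to a plane through \<open>0\<close> and \<open>x\<close>, then \<open>ln t / 2\<close> is the mean of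
  \<open>ln |x - y|\<close> over the rotations of \<open>y\<close> in that plane.
\<close>

definition circ :: "real \<Rightarrow> real \<Rightarrow> real \<Rightarrow> real" where
  "circ r s k = (r\<^sup>2 + s\<^sup>2 + sqrt ((r\<^sup>2 + s\<^sup>2)\<^sup>2 - 4 * r\<^sup>2 * k)) / 2"

text \<open>The derivative of \<open>ln (circ r s k) / 2\<close> with respect to \<open>ln r\<close>; meaningful only for \<open>r \<noteq> s\<close>.\<close>

definition circ_deriv :: "real \<Rightarrow> real \<Rightarrow> real \<Rightarrow> real" where
  "circ_deriv r s k = (1 + (r\<^sup>2 - s\<^sup>2) / sqrt ((r\<^sup>2 + s\<^sup>2)\<^sup>2 - 4 * r\<^sup>2 * k)) / 2"

section \<open>Bounds for the larger root and its logarithmic derivative\<close>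

lemma disc_ge:
  fixes r s k :: real
  assumes "k \<le> s\<^sup>2"
  shows "(r\<^sup>2 - s\<^sup>2)\<^sup>2 \<le> (r\<^sup>2 + s\<^sup>2)\<^sup>2 - 4 * r\<^sup>2 * k"
proof -
  have "4 * r\<^sup>2 * k \<le> 4 * r\<^sup>2 * s\<^sup>2"
    using assms by (intro mult_left_mono) auto
  then show ?thesis by (simp add: power2_eq_square algebra_simps)
qed

lemma sqrt_disc_ge:
  fixes r s k :: real
  assumes "k \<le> s\<^sup>2"
  shows "\<bar>r\<^sup>2 - s\<^sup>2\<bar> \<le> sqrt ((r\<^sup>2 + s\<^sup>2)\<^sup>2 - 4 * r\<^sup>2 * k)"
  using disc_ge[OF assms] by (rule real_le_rsqrt[of "\<bar>r\<^sup>2 - s\<^sup>2\<bar>", simplified])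

lemma circ_ge:
  assumes "k \<le> s\<^sup>2"
  shows "r\<^sup>2 \<le> circ r s k" "s\<^sup>2 \<le> circ r s k"
  using sqrt_disc_ge[OF assms, of r] unfolding circ_def by (auto simp: field_simps)

lemma circ_root:
  assumes "k \<le> s\<^sup>2"
  shows "(circ r s k)\<^sup>2 + r\<^sup>2 * k = (r\<^sup>2 + s\<^sup>2) * circ r s k"
proof -
  define W where "W = sqrt ((r\<^sup>2 + s\<^sup>2)\<^sup>2 - 4 * r\<^sup>2 * k)"
  have "0 \<le> (r\<^sup>2 + s\<^sup>2)\<^sup>2 - 4 * r\<^sup>2 * k"
    using disc_ge[OF assms, of r] by (rule order_trans[rotated]) simp
  then have W2: "W\<^sup>2 = (r\<^sup>2 + s\<^sup>2)\<^sup>2 - 4 * (r\<^sup>2 * k)"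
    by (simp add: W_def)
  have C: "circ r s k = (r\<^sup>2 + s\<^sup>2 + W) / 2"
    by (simp add: circ_def W_def)
  have "((P + W) / 2)\<^sup>2 + x = P * ((P + W) / 2)" if "W\<^sup>2 = P\<^sup>2 - 4 * x" for P x
  proof -
    have "((P + W) / 2)\<^sup>2 + x = (P\<^sup>2 + 2 * P * W + (W\<^sup>2 + 4 * x)) / 4"
      by (simp add: power2_sum power_divide field_simps)
    also have "W\<^sup>2 + 4 * x = P\<^sup>2" using that by simp
    finally show ?thesis by (simp add: power2_eq_square field_simps)
  qed
  from this[OF W2] show ?thesis unfolding C[symmetric] .
qed

text \<open>Where the quadratic is nonpositive, \<open>t\<close> lies between its roots.\<close>

lemma le_circI:
  assumes "k \<le> s\<^sup>2" "t\<^sup>2 + r\<^sup>2 * k \<le> (r\<^sup>2 + s\<^sup>2) * t"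
  shows "t \<le> circ r s k"
proof -
  define W where "W = (r\<^sup>2 + s\<^sup>2)\<^sup>2 - 4 * r\<^sup>2 * k"
  have "(2 * t - (r\<^sup>2 + s\<^sup>2))\<^sup>2 = 4 * (t\<^sup>2 - (r\<^sup>2 + s\<^sup>2) * t) + (r\<^sup>2 + s\<^sup>2)\<^sup>2"
    by (simp add: power2_eq_square algebra_simps)
  also have "\<dots> \<le> 4 * (- (r\<^sup>2 * k)) + (r\<^sup>2 + s\<^sup>2)\<^sup>2"
    using assms(2) by (intro add_mono mult_left_mono) auto
  also have "\<dots> = W" by (simp add: W_def)
  finally have "2 * t - (r\<^sup>2 + s\<^sup>2) \<le> sqrt W"
    by (rule real_le_rsqrt)
  then show ?thesis unfolding circ_def W_def by simp
qed

text \<open>Where the quadratic is nonnegative and \<open>t\<close> is to the right of the vertex,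
  \<open>t\<close> is beyond the larger root.\<close>

lemma circ_leI:
  assumes "k \<le> s\<^sup>2" "(r\<^sup>2 + s\<^sup>2) * t \<le> t\<^sup>2 + r\<^sup>2 * k" "r\<^sup>2 + s\<^sup>2 \<le> 2 * t"
  shows "circ r s k \<le> t"
proof -
  define W where "W = (r\<^sup>2 + s\<^sup>2)\<^sup>2 - 4 * r\<^sup>2 * k"
  have "W = 4 * (- (r\<^sup>2 * k)) + (r\<^sup>2 + s\<^sup>2)\<^sup>2" by (simp add: W_def)
  also have "\<dots> \<le> 4 * (t\<^sup>2 - (r\<^sup>2 + s\<^sup>2) * t) + (r\<^sup>2 + s\<^sup>2)\<^sup>2"
    using assms(2) by (intro add_mono mult_left_mono) auto
  also have "\<dots> = (2 * t - (r\<^sup>2 + s\<^sup>2))\<^sup>2"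
    by (simp add: power2_eq_square algebra_simps)
  finally have "sqrt W \<le> 2 * t - (r\<^sup>2 + s\<^sup>2)"
    using assms(3) by (intro real_le_lsqrt) auto
  then show ?thesis unfolding circ_def W_def by simp
qed

text \<open>Raising \<open>r\<close> to \<open>r'\<close> changes the quadratic at the old root
  \<open>t\<close> by \<open>- (r'\<^sup>2 - r\<^sup>2) * (t - k)\<close>, which is nonpositive
  because \<open>t \<ge> s\<^sup>2 \<ge> k\<close>.\<close>

lemma circ_mono:
  assumes "k \<le> s\<^sup>2" "0 \<le> r" "r \<le> r'"
  shows "circ r s k \<le> circ r' s k"
proof (rule le_circI[OF assms(1)])
  let ?t = "circ r s k"
  have "r\<^sup>2 * (?t - k) \<le> r'\<^sup>2 * (?t - k)"
    using assms circ_ge(2)[OF assms(1), of r] by (intro mult_right_mono power_mono) auto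
  then show "?t\<^sup>2 + r'\<^sup>2 * k \<le> (r'\<^sup>2 + s\<^sup>2) * ?t"
    using circ_root[OF assms(1), of r] by (simp add: algebra_simps)
qed

text \<open>With \<open>t\<close> the old root, the new quadratic at \<open>c\<^sup>2 * t\<close>
  equals \<open>c\<^sup>2 * (c\<^sup>2 - 1) * t * (t - r\<^sup>2)\<close>, which is
  nonnegative.\<close>

lemma circ_scale_le:
  assumes k: "k \<le> s\<^sup>2" and "1 \<le> c"
  shows "circ (c * r) s k \<le> c\<^sup>2 * circ r s k"
proof (rule circ_leI[OF k])
  let ?t = "circ r s k"
  have c: "1 \<le> c\<^sup>2" using \<open>1 \<le> c\<close> by (simp add: one_le_power)
  have "0 \<le> ?t" using circ_ge(1)[OF k, of r] zero_le_power2[of r] by linarith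
  then have "0 \<le> c\<^sup>2 * ((c\<^sup>2 - 1) * (?t * (?t - r\<^sup>2)))"
    using c circ_ge(1)[OF k, of r] by (intro mult_nonneg_nonneg) auto
  also have "\<dots> = (c\<^sup>2 * ?t)\<^sup>2 + c\<^sup>2 * ((r\<^sup>2 + s\<^sup>2) * ?t - ?t\<^sup>2) - ((c * r)\<^sup>2 + s\<^sup>2) * (c\<^sup>2 * ?t)"
    by (simp add: power2_eq_square algebra_simps)
  also have "(r\<^sup>2 + s\<^sup>2) * ?t - ?t\<^sup>2 = r\<^sup>2 * k"
    using circ_root[OF k, of r] by simp
  finally show "((c * r)\<^sup>2 + s\<^sup>2) * (c\<^sup>2 * ?t) \<le> (c\<^sup>2 * ?t)\<^sup>2 + (c * r)\<^sup>2 * k"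
    by (simp add: power2_eq_square algebra_simps)
  have "s\<^sup>2 \<le> c\<^sup>2 * s\<^sup>2" using mult_right_mono[OF c, of "s\<^sup>2"] by simp
  then have "(c * r)\<^sup>2 + s\<^sup>2 \<le> c\<^sup>2 * (r\<^sup>2 + s\<^sup>2)"
    by (simp add: power_mult_distrib algebra_simps)
  also have "\<dots> \<le> c\<^sup>2 * (2 * ?t)"
    using circ_ge[OF k, of r] by (intro mult_left_mono) auto
  finally show "(c * r)\<^sup>2 + s\<^sup>2 \<le> 2 * (c\<^sup>2 * ?t)" by simp
qed

lemma circ_pos:
  assumes "k \<le> s\<^sup>2" "0 < r \<or> s \<noteq> 0"
  shows "0 < circ r s k"
  using circ_ge[OF assms(1), of r] assms(2)
  by (metis less_le_trans zero_less_power2 less_irrefl)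

text \<open>Monotonicity gives the lower bound. For the upper one, the factor
  \<open>(exp h)\<^sup>2\<close> from scaling contributes \<open>2 * h\<close> to the logarithm,
  which is then halved.\<close>

lemma ln_circ_dilate:
  assumes k: "k \<le> s\<^sup>2" and "0 \<le> r" "0 \<le> h"
  shows "ln (circ r s k) / 2 \<le> ln (circ (exp h * r) s k) / 2"
    and "ln (circ (exp h * r) s k) / 2 \<le> ln (circ r s k) / 2 + h"
proof -
  have "ln (circ r s k) / 2 \<le> ln (circ (exp h * r) s k) / 2 \<and>
     ln (circ (exp h * r) s k) / 2 \<le> ln (circ r s k) / 2 + h"
  proof (cases "r = 0")
    case False
    then have r: "0 < r" using \<open>0 \<le> r\<close> by simp
    have e: "1 \<le> exp h" using \<open>0 \<le> h\<close> by simp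
    have p: "0 < circ r s k" "0 < circ (exp h * r) s k"
      using r by (auto intro!: circ_pos[OF k])
    have "circ r s k \<le> circ (exp h * r) s k"
      using r e by (intro circ_mono[OF k]) auto
    moreover have "ln (circ (exp h * r) s k) \<le> ln ((exp h)\<^sup>2 * circ r s k)"
      using circ_scale_le[OF k e, of r] p by simp
    moreover have "ln ((exp h)\<^sup>2 * circ r s k) = 2 * h + ln (circ r s k)"
      using p by (simp add: ln_mult ln_realpow)
    ultimately show ?thesis using p by simp
  qed (use \<open>0 \<le> h\<close> in simp)
  then show "ln (circ r s k) / 2 \<le> ln (circ (exp h * r) s k) / 2"
    "ln (circ (exp h * r) s k) / 2 \<le> ln (circ r s k) / 2 + h" by auto
qed

text \<open>A negative \<open>h\<close> is treated by starting from the radius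
  \<open>exp h * r\<close> and dilating back by \<open>- h\<close>.\<close>

lemma abs_ln_circ_dilate:
  assumes k: "k \<le> s\<^sup>2" and "0 \<le> r"
  shows "\<bar>ln (circ (exp h * r) s k) / 2 - ln (circ r s k) / 2\<bar> \<le> \<bar>h\<bar>"
proof (cases "0 \<le> h")
  case True
  then show ?thesis using ln_circ_dilate[OF k \<open>0 \<le> r\<close> True] by simp
next
  case False
  then have "0 \<le> - h" by simp
  moreover have e: "exp (- h) * (exp h * r) = r"
    by (simp add: exp_minus)
  moreover have "0 \<le> exp h * r" using \<open>0 \<le> r\<close> by simp
  ultimately show ?thesis
    using ln_circ_dilate[OF k, of "exp h * r" "- h", unfolded e] by linarith
qed

lemma circ_deriv_bounds:
  assumes k: "k \<le> s\<^sup>2"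
  shows "0 \<le> circ_deriv r s k" "circ_deriv r s k \<le> 1"
proof -
  define W where "W = sqrt ((r\<^sup>2 + s\<^sup>2)\<^sup>2 - 4 * r\<^sup>2 * k)"
  have "\<bar>r\<^sup>2 - s\<^sup>2\<bar> \<le> W" using sqrt_disc_ge[OF k] by (simp add: W_def)
  \<comment> \<open>For \<open>W = 0\<close> the quotient is \<open>0\<close> by convention, so the
    bounds hold for every pair of radii.\<close>
  then have *: "\<bar>(r\<^sup>2 - s\<^sup>2) / W\<bar> \<le> 1"
    by (cases "W = 0") (auto simp: abs_le_iff field_simps abs_divide)
  have "0 \<le> (1 + x) / 2" "(1 + x) / 2 \<le> 1" if "\<bar>x\<bar> \<le> 1" for x :: real
    using that by (simp_all add: abs_le_iff)
  from this[OF *] show "0 \<le> circ_deriv r s k" "circ_deriv r s k \<le> 1"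
    unfolding circ_deriv_def W_def[symmetric] .
qed

lemma circ_deriv_ge_half:
  assumes "k \<le> s\<^sup>2" "0 \<le> s" "s \<le> r"
  shows "1 / 2 \<le> circ_deriv r s k"
proof -
  have "s\<^sup>2 \<le> r\<^sup>2" using assms by (intro power_mono) auto
  moreover have "0 \<le> sqrt ((r\<^sup>2 + s\<^sup>2)\<^sup>2 - 4 * r\<^sup>2 * k)"
    using sqrt_disc_ge[OF assms(1), of r] by (rule order_trans[rotated]) simp
  ultimately show ?thesis unfolding circ_deriv_def by simp
qed

text \<open>Distinct radii make the discriminant strictly positive, so its square root
  \<open>W\<close> is differentiable and the chain rule applies.\<close>

lemma has_derivative_ln_circ:
  assumes k: "k \<le> s\<^sup>2" and rs: "0 \<le> r" "0 \<le> s" "r \<noteq> s"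
  shows "((\<lambda>h. ln (circ (exp h * r) s k) / 2) has_real_derivative circ_deriv r s k) (at 0)"
proof -
  define W where "W = sqrt ((r\<^sup>2 + s\<^sup>2)\<^sup>2 - 4 * r\<^sup>2 * k)"
  define P where "P = r\<^sup>2 + s\<^sup>2"
  have "r\<^sup>2 \<noteq> s\<^sup>2" using rs by (simp add: power2_eq_iff_nonneg)
  then have "0 < \<bar>r\<^sup>2 - s\<^sup>2\<bar>" by simp
  then have W: "0 < W" using sqrt_disc_ge[OF k, of r] unfolding W_def by linarith
  then have W2: "W * W = P\<^sup>2 - 4 * r\<^sup>2 * k"
    unfolding W_def P_def by (simp add: real_sqrt_gt_0_iff)
  have pos: "0 < (r\<^sup>2 + s\<^sup>2)\<^sup>2 - 4 * r\<^sup>2 * k"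
    using W unfolding W_def by simp
  have T: "0 < r\<^sup>2 + s\<^sup>2 + W"
    using W by (simp add: add_nonneg_pos)
  let ?g = "\<lambda>h. (exp h * r)\<^sup>2 + s\<^sup>2" and ?d = "\<lambda>h. ((exp h * r)\<^sup>2 + s\<^sup>2)\<^sup>2 - 4 * (exp h * r)\<^sup>2 * k"
  have 1: "(?g has_real_derivative 2 * r\<^sup>2) (at 0)"
    by (auto intro!: derivative_eq_intros simp: power2_eq_square)
  have 2: "(?d has_real_derivative 2 * P * (2 * r\<^sup>2) - 8 * r\<^sup>2 * k) (at 0)"
    by (auto intro!: derivative_eq_intros simp: P_def power2_eq_square algebra_simps)
  have d0: "?d 0 = (r\<^sup>2 + s\<^sup>2)\<^sup>2 - 4 * r\<^sup>2 * k" by simp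
  have 3: "((\<lambda>h. sqrt (?d h)) has_real_derivative inverse W / 2 * (2 * P * (2 * r\<^sup>2) - 8 * r\<^sup>2 * k)) (at 0)"
  proof -
    have "0 < ?d 0" unfolding d0 by (rule pos)
    from DERIV_chain2[OF DERIV_real_sqrt[OF this] 2]
    show ?thesis unfolding d0 W_def[symmetric] .
  qed
  have 4: "((\<lambda>h. circ (exp h * r) s k) has_real_derivative
     (2 * r\<^sup>2 + inverse W / 2 * (2 * P * (2 * r\<^sup>2) - 8 * r\<^sup>2 * k)) / 2) (at 0)"
    unfolding circ_def by (intro DERIV_cdivide DERIV_add 1 3)
  have c0: "circ (exp 0 * r) s k = (P + W) / 2"
    by (simp add: circ_def P_def W_def)
  have "0 < circ (exp 0 * r) s k" unfolding c0 using T by (simp add: P_def)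
  have e1: "inverse W / 2 * Q = Q / (2 * W)" for Q
    using W by (simp add: field_simps)
  have e2: "1 / (S / 2) * (X / 2) / 2 = X / S / 2" for X S :: real
    by (cases "S = 0") (simp_all add: field_simps)
  from DERIV_cdivide[OF DERIV_chain2[OF DERIV_ln_divide[OF \<open>0 < circ (exp 0 * r) s k\<close>] 4], of 2]
  have D: "((\<lambda>h. ln (circ (exp h * r) s k) / 2) has_real_derivative
     (2 * r\<^sup>2 + (2 * P * (2 * r\<^sup>2) - 8 * r\<^sup>2 * k) / (2 * W)) / (P + W) / 2) (at 0)"
    unfolding c0 e1 e2 .
  have "(2 * r\<^sup>2 + (2 * P * (2 * r\<^sup>2) - 8 * r\<^sup>2 * k) / (2 * W)) / (P + W) / 2
     = (1 + (2 * r\<^sup>2 - P) / W) / 2"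
  proof -
    have PW: "P + W > 0" using T by (simp add: P_def)
    have "(2 * r\<^sup>2 + (2 * P * (2 * r\<^sup>2) - 8 * r\<^sup>2 * k) / (2 * W)) * W
        = 2 * r\<^sup>2 * W + 2 * P * r\<^sup>2 - 4 * r\<^sup>2 * k"
      using W by (simp add: field_simps)
    \<comment> \<open>Once \<open>k\<close> is eliminated in favour of \<open>W\<close>, the
      numerator contains the factor \<open>P + W\<close>, which cancels against the root in the
      denominator.\<close>
    also have "4 * r\<^sup>2 * k = P\<^sup>2 - W * W" using W2 by simp
    also have "2 * r\<^sup>2 * W + 2 * P * r\<^sup>2 - (P\<^sup>2 - W * W) = (W + (2 * r\<^sup>2 - P)) * (P + W)"
      by (simp add: power2_eq_square algebra_simps)
    finally have "(2 * r\<^sup>2 + (2 * P * (2 * r\<^sup>2) - 8 * r\<^sup>2 * k) / (2 * W)) * W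
      = (W + (2 * r\<^sup>2 - P)) * (P + W)" .
    then have 5: "(2 * r\<^sup>2 + (2 * P * (2 * r\<^sup>2) - 8 * r\<^sup>2 * k) / (2 * W))
       = (W + (2 * r\<^sup>2 - P)) * (P + W) / W"
      using W by (simp only: nonzero_eq_divide_eq less_imp_neq[OF W, symmetric] not_False_eq_True)
    have "(W + Y) * S / W / S / 2 = (1 + Y / W) / 2" if "0 < S" for Y S
      using W that by (simp add: field_simps)
    from this[of "P + W" "2 * r\<^sup>2 - P"] show ?thesis
      unfolding 5 by (simp only: PW)
  qed
  also have "\<dots> = circ_deriv r s k"
    unfolding circ_deriv_def W_def[symmetric] by (simp add: P_def)
  finally show ?thesis using D by simp
qed

text \<open>The squared distance factors as \<open>T * (norm (1 - q * cis t))\<^sup>2\<close> with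
  \<open>q = r * w / T\<close>. Comparing constant terms gives the quadratic equation for
  \<open>T\<close>; its larger root satisfies \<open>T > r * s\<close>, so \<open>norm q < 1\<close>
  and the second factor has logarithmic mean \<open>0\<close>.\<close>

lemma circle_mean_ln_circ:
  fixes w :: complex
  assumes "norm w \<le> s" "0 \<le> r" "r \<noteq> s"
  shows "((\<lambda>t. ln (r\<^sup>2 + s\<^sup>2 - 2 * r * Re (w * cis t)) / 2) has_integral
     2 * pi * (ln (circ r s ((norm w)\<^sup>2)) / 2)) {0..2*pi}"
proof -
  have s: "0 \<le> s" using assms(1) norm_ge_zero order_trans by blast
  have k: "(norm w)\<^sup>2 \<le> s\<^sup>2" using assms(1) by (intro power_mono) auto
  define T where "T = circ r s ((norm w)\<^sup>2)"
  have T: "0 < T" "r\<^sup>2 \<le> T" "s\<^sup>2 \<le> T"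
    using circ_pos[OF k, of r] circ_ge[OF k, of r] assms s unfolding T_def by (auto simp: less_le)
  have root: "T\<^sup>2 + r\<^sup>2 * (norm w)\<^sup>2 = (r\<^sup>2 + s\<^sup>2) * T"
    using circ_root[OF k] by (simp add: T_def)
  define q where "q = of_real (r / T) * w"
  have nq: "norm q = r * norm w / T"
    using T assms by (simp add: q_def norm_mult norm_divide)
  have "r * norm w \<le> r * s" using assms by (intro mult_left_mono) auto
  moreover have "r * s < T"
  proof -
    have "0 < (r - s)\<^sup>2" using assms by simp
    also have "(r - s)\<^sup>2 = r\<^sup>2 + s\<^sup>2 - 2 * (r * s)"
      by (simp add: power2_eq_square algebra_simps)
    finally show ?thesis using T by linarith
  qed
  ultimately have q1: "norm q < 1"
    using T by (simp add: nq)
  have eq: "r\<^sup>2 + s\<^sup>2 - 2 * r * Re (w * cis t) = T * (norm (1 - q * cis t))\<^sup>2" for t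
  proof -
    have "(norm (1 - z))\<^sup>2 = 1 + (norm z)\<^sup>2 - 2 * Re z" for z
      unfolding cmod_power2 by (simp add: power2_eq_square algebra_simps)
    then have "T * (norm (1 - q * cis t))\<^sup>2 = T * (1 + (norm q)\<^sup>2 - 2 * Re (q * cis t))"
      by (simp add: norm_mult)
    also have "Re (q * cis t) = r / T * Re (w * cis t)"
      unfolding q_def by (simp add: mult.assoc del: of_real_divide)
    also have "T * (1 + (norm q)\<^sup>2 - 2 * (r / T * Re (w * cis t)))
       = (T\<^sup>2 + r\<^sup>2 * (norm w)\<^sup>2) / T - 2 * r * Re (w * cis t)"
      using T by (simp add: nq field_simps power2_eq_square)
    also have "(T\<^sup>2 + r\<^sup>2 * (norm w)\<^sup>2) / T = r\<^sup>2 + s\<^sup>2"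
      using T by (simp add: root)
    finally show ?thesis by simp
  qed
  have "((\<lambda>t. ln T / 2 + ln (norm (1 - q * cis t))) has_integral (2 * pi * (ln T / 2) + 0)) {0..2*pi}"
    using has_integral_const_real[of "ln T / 2" 0 "2 * pi"]
    by (intro has_integral_add circle_mean_ln_norm[OF q1]) simp
  moreover have "ln (r\<^sup>2 + s\<^sup>2 - 2 * r * Re (w * cis t)) / 2 = ln T / 2 + ln (norm (1 - q * cis t))" for t
  proof -
    have "norm (q * cis t) < 1" using q1 by (simp add: norm_mult)
    then have "1 - q * cis t \<noteq> 0" by (metis norm_one less_irrefl eq_iff_diff_eq_0)
    then show ?thesis
      unfolding eq using T by (simp add: ln_mult ln_realpow)
  qed
  ultimately show ?thesis
    unfolding T_def[symmetric] by (simp only: add_0_right)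
qed

section \<open>Averaging over the rotations of a coordinate plane\<close>

text \<open>Local boundedness is included to control the logarithmic singularity of the
  kernel.\<close>

definition radial_density :: "('a::euclidean_space \<Rightarrow> real) \<Rightarrow> bool" where
  "radial_density f \<longleftrightarrow> integrable lborel f \<and> (\<forall>y. 0 \<le> f y) \<and> radially_symmetric f \<and>
     (\<forall>R. \<exists>M. \<forall>y. norm y \<le> R \<longrightarrow> \<bar>f y\<bar> \<le> M)"

lemma radial_densityD:
  assumes "radial_density f"
  shows "integrable lborel f" "f \<in> borel_measurable borel" "0 \<le> f y"
    "norm y = norm z \<Longrightarrow> f y = f z" "\<exists>M. \<forall>y. norm y \<le> R \<longrightarrow> \<bar>f y\<bar> \<le> M"
proof -
  show int: "integrable lborel f"
    using assms by (simp only: radial_density_def)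
  show "f \<in> borel_measurable borel"
    using borel_measurable_integrable[OF int] by simp
  note * = assms[unfolded radial_density_def radially_symmetric_def, THEN conjunct2]
  show "0 \<le> f y" by (rule spec[OF *[THEN conjunct1]])
  show "norm y = norm z \<Longrightarrow> f y = f z"
    by (rule *[THEN conjunct2, THEN conjunct1, rule_format])
  show "\<exists>M. \<forall>y. norm y \<le> R \<longrightarrow> \<bar>f y\<bar> \<le> M"
    by (rule spec[OF *[THEN conjunct2, THEN conjunct2]])
qed

lemma radial_density_add:
  assumes "radial_density f" "radial_density g"
  shows "radial_density (\<lambda>x. f x + g x)"
  unfolding radial_density_def
proof (intro conjI allI)
  note F = radial_densityD[OF assms(1)] and G = radial_densityD[OF assms(2)]
  show "integrable lborel (\<lambda>x. f x + g x)" using F(1) G(1) by simp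
  show "0 \<le> f y + g y" for y using F(3) G(3) by simp
  show "radially_symmetric (\<lambda>x. f x + g x)"
    unfolding radially_symmetric_def using F(4) G(4) by metis
  fix R
  obtain M N where "\<And>y. norm y \<le> R \<Longrightarrow> \<bar>f y\<bar> \<le> M" "\<And>y. norm y \<le> R \<Longrightarrow> \<bar>g y\<bar> \<le> N"
    using F(5)[of R] G(5)[of R] by blast
  then have "\<forall>y. norm y \<le> R \<longrightarrow> \<bar>f y + g y\<bar> \<le> M + N"
    by (meson abs_triangle_ineq add_mono order_trans)
  then show "\<exists>M. \<forall>y. norm y \<le> R \<longrightarrow> \<bar>f y + g y\<bar> \<le> M" ..
qed

lemma radial_density_truncate:
  assumes "radial_density f"
  shows "radial_density (\<lambda>x. indicator (ball 0 \<rho>) x * f x)"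
  unfolding radial_density_def
proof (intro conjI allI)
  note F = radial_densityD[OF assms]
  have [measurable]: "f \<in> borel_measurable borel" by (rule F(2))
  show "integrable lborel (\<lambda>x. indicator (ball 0 \<rho>) x * f x)"
    by (rule Bochner_Integration.integrable_bound[OF F(1)]) (auto simp: indicator_def)
  show "0 \<le> indicator (ball 0 \<rho>) y * f y" for y using F(3) by simp
  show "radially_symmetric (\<lambda>x. indicator (ball 0 \<rho>) x * f x)"
    unfolding radially_symmetric_def
  proof (intro allI impI)
    fix x y :: 'a assume "norm x = norm y"
    then have "f x = f y" "indicator (ball 0 \<rho>) x = (indicator (ball 0 \<rho>) y :: real)"
      by (auto intro: F(4) simp: indicator_def)
    then show "indicator (ball 0 \<rho>) x * f x = indicator (ball 0 \<rho>) y * f y" by simp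
  qed
  fix R
  obtain M where M: "\<And>y. norm y \<le> R \<Longrightarrow> \<bar>f y\<bar> \<le> M"
    using F(5)[of R] by blast
  have "\<bar>indicator (ball 0 \<rho>) y * f y\<bar> \<le> \<bar>f y\<bar>" for y
    by (simp add: indicator_def)
  with M show "\<exists>M. \<forall>y. norm y \<le> R \<longrightarrow> \<bar>indicator (ball 0 \<rho>) y * f y\<bar> \<le> M"
    by (meson order_trans)
qed

text \<open>The rotations of one coordinate plane form a circle, so averages over them are integrals
  over \<open>{0..2*pi}\<close>.\<close>

locale coord_plane =
  fixes i j :: "'n::finite"
  assumes ij: "i \<noteq> j"
begin

definition rot :: "real \<Rightarrow> real ^ 'n \<Rightarrow> real ^ 'n" where
  "rot t y = (\<chi> m. if m = i then cos t * y $ i - sin t * y $ j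
     else if m = j then sin t * y $ i + cos t * y $ j else y $ m)"

lemma norm_power2_split:
  fixes y :: "real ^ 'n"
  shows "(norm y)\<^sup>2 = (y $ i)\<^sup>2 + (y $ j)\<^sup>2 + (\<Sum>m\<in>UNIV - {i, j}. (y $ m)\<^sup>2)"
proof -
  have "(norm y)\<^sup>2 = (\<Sum>m\<in>UNIV. (y $ m)\<^sup>2)"
    unfolding power2_norm_eq_inner by (simp add: inner_vec_def power2_eq_square)
  also have "\<dots> = (\<Sum>m\<in>{i, j}. (y $ m)\<^sup>2) + (\<Sum>m\<in>UNIV - {i, j}. (y $ m)\<^sup>2)"
    by (subst sum.subset_diff[of "{i, j}"]) auto
  finally show ?thesis using ij by simp
qed

lemma orthogonal_transformation_rot: "orthogonal_transformation (rot t)"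
  unfolding orthogonal_transformation
proof
  show "linear (rot t)"
    by (rule linearI) (simp_all add: rot_def vec_eq_iff algebra_simps)
  show "\<forall>v. norm (rot t v) = norm v"
  proof
    fix v
    have "(cos t * a - sin t * b)\<^sup>2 + (sin t * a + cos t * b)\<^sup>2 = a\<^sup>2 + b\<^sup>2" for a b
      using sin_cos_squared_add[of t] by algebra
    then have "(norm (rot t v))\<^sup>2 = (norm v)\<^sup>2"
      unfolding norm_power2_split using ij by (simp add: rot_def)
    then show "norm (rot t v) = norm v" by simp
  qed
qed

lemmas norm_rot [simp] = orthogonal_transformation_norm[OF orthogonal_transformation_rot]

lemma measurable_rot [measurable]: "(\<lambda>(t, y). rot t y) \<in> borel_measurable (borel \<Otimes>\<^sub>M borel)"
proof -
  have "continuous_on UNIV (\<lambda>z. if m = i then cos (fst z :: real) * snd z $ i - sin (fst z) * snd z $ j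
     else if m = j then sin (fst z) * snd z $ i + cos (fst z) * snd z $ j else snd z $ m)" for m
    by (cases "m = i"; cases "m = j") (auto intro!: continuous_intros)
  then have "continuous_on UNIV (\<lambda>z. rot (fst z) (snd z))"
    unfolding rot_def by (intro continuous_on_vec_lambda)
  then show ?thesis
    unfolding borel_prod case_prod_beta' by (rule borel_measurable_continuous_onI)
qed

definition plane_sq :: "real ^ 'n \<Rightarrow> real" where
  "plane_sq y = (y $ i)\<^sup>2 + (y $ j)\<^sup>2"

lemma plane_sq_le: "plane_sq y \<le> (norm y)\<^sup>2"
  unfolding norm_power2_split plane_sq_def by (simp add: sum_nonneg)

lemma borel_measurable_plane_sq [measurable]: "plane_sq \<in> borel_measurable borel"
  unfolding plane_sq_def[abs_def] by measurable

definition ring_ln :: "real \<Rightarrow> real ^ 'n \<Rightarrow> real" where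
  "ring_ln r y = ln (circ r (norm y) (plane_sq y)) / 2"

text \<open>The law of cosines, with the plane identified with the complex numbers so that
  \<open>rot t\<close> becomes multiplication by \<open>cis t\<close>.\<close>

lemma norm_axis_minus_rot:
  "(norm (r *\<^sub>R axis i 1 - rot t y))\<^sup>2 = r\<^sup>2 + (norm y)\<^sup>2 - 2 * r * Re (Complex (y $ i) (y $ j) * cis t)"
proof -
  have "(norm (v - w))\<^sup>2 = (norm v)\<^sup>2 + (norm w)\<^sup>2 - 2 * (v \<bullet> w)" for v w :: "real ^ 'n"
    by (simp add: power2_norm_eq_inner inner_diff inner_commute)
  then have "(norm (r *\<^sub>R axis i 1 - rot t y))\<^sup>2 = (norm (r *\<^sub>R axis i 1 :: real ^ 'n))\<^sup>2 + (norm (rot t y))\<^sup>2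
     - 2 * ((r *\<^sub>R axis i 1) \<bullet> rot t y)"
    by blast
  also have "(r *\<^sub>R axis i 1) \<bullet> rot t y = r * (rot t y $ i)"
    by (simp add: inner_axis')
  also have "rot t y $ i = Re (Complex (y $ i) (y $ j) * cis t)"
    by (simp add: rot_def mult.commute)
  finally show ?thesis by simp
qed

lemma rotation_mean_ln:
  assumes "0 \<le> r" "norm y \<noteq> r"
  shows "((\<lambda>t. ln (norm (r *\<^sub>R axis i 1 - rot t y))) has_integral 2 * pi * ring_ln r y) {0..2*pi}"
proof -
  let ?w = "Complex (y $ i) (y $ j)"
  have nw: "(norm ?w)\<^sup>2 = plane_sq y" by (simp add: cmod_power2 plane_sq_def)
  have "norm ?w \<le> norm y"
    by (rule power2_le_imp_le) (simp_all only: nw plane_sq_le norm_ge_zero)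
  from circle_mean_ln_circ[OF this assms(1) assms(2)[symmetric]]
  have "((\<lambda>t. ln ((norm (r *\<^sub>R axis i 1 - rot t y))\<^sup>2) / 2) has_integral 2 * pi * ring_ln r y) {0..2*pi}"
    unfolding norm_axis_minus_rot nw ring_ln_def .
  moreover have "ln ((norm z)\<^sup>2) / 2 = ln (norm z)" for z :: "real ^ 'n"
    by (cases "z = 0") (simp_all add: ln_realpow)
  ultimately show ?thesis by simp
qed

lemma continuous_on_rot: "continuous_on S (\<lambda>t. rot t y)"
proof -
  have *: "continuous_on S (\<lambda>t::real. cos t * a - sin t * b)"
    "continuous_on S (\<lambda>t::real. sin t * a + cos t * b)" for a b :: real
    by (intro continuous_intros)+
  have "continuous_on S (\<lambda>t::real. if m = i then cos t * y $ i - sin t * y $ j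
     else if m = j then sin t * y $ i + cos t * y $ j else y $ m)" for m
    using * by (cases "m = i"; cases "m = j") simp_all
  then show ?thesis
    unfolding rot_def by (intro continuous_on_vec_lambda)
qed

text \<open>Orthogonal maps preserve \<open>f\<close> and Lebesgue measure. Hence \<open>x\<close>
  may be moved onto the axis, and the kernel may be replaced by its mean over \<open>rot t\<close>,
  with Fubini exchanging the mean and the integral. The subtracted \<open>ln (norm y)\<close> makes
  the kernel integrable against \<open>f\<close>.\<close>

lemma
  assumes f: "radial_density f"
  shows integrable_ring_ln: "integrable lborel (\<lambda>y. (ring_ln (norm x) y - ln (norm y)) * f y)" (is ?int)
    and log_potential_eq_ring_ln:
      "(\<integral>y. (ln (norm (x - y)) - ln (norm y)) * f y \<partial>lborel)
        = (\<integral>y. (ring_ln (norm x) y - ln (norm y)) * f y \<partial>lborel)" (is ?eq)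
proof -
  note F = radial_densityD[OF f]
  have [measurable]: "f \<in> borel_measurable borel" by (rule F(2))
  define r where "r = norm x"
  define e where "e = (r *\<^sub>R axis i 1 :: real ^ 'n)"
  define h where "h y = (ln (norm (e - y)) - ln (norm y)) * f y" for y
  have ne: "norm e = r" by (simp add: e_def r_def)
  have [measurable]: "h \<in> borel_measurable borel"
    unfolding h_def[abs_def] by measurable
  have h: "integrable lborel h"
    using integrable_ln_norm_diff[OF F(1,5), of e 0]
    unfolding h_def[abs_def] by (simp add: norm_minus_commute)
  obtain T where T: "orthogonal_transformation T" "T e = x"
    using orthogonal_transformation_exists[of e x] ne by (auto simp: r_def)
  have "(\<integral>y. (ln (norm (x - y)) - ln (norm y)) * f y \<partial>lborel)
      = (\<integral>y. (ln (norm (x - T y)) - ln (norm (T y))) * f (T y) \<partial>lborel)"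
    by (rule lborel_integral_orthogonal[OF T(1), symmetric]) measurable
  also have "\<dots> = (\<integral>y. h y \<partial>lborel)"
  proof (rule Bochner_Integration.integral_cong[OF refl])
    fix y
    have "x - T y = T (e - y)"
      using T by (simp add: linear_diff orthogonal_transformation_linear)
    moreover have "f (T y) = f y"
      by (intro F(4) orthogonal_transformation_norm[OF T(1)])
    ultimately show "(ln (norm (x - T y)) - ln (norm (T y))) * f (T y) = h y"
      by (simp add: h_def orthogonal_transformation_norm[OF T(1)])
  qed
  finally have 1: "(\<integral>y. (ln (norm (x - y)) - ln (norm y)) * f y \<partial>lborel) = (\<integral>y. h y \<partial>lborel)" .

  \<comment> \<open>The indicator turns the mean over a period into an integral over the whole line,
    so that Fubini for two Lebesgue measures applies.\<close>
  define H where "H t y = indicator {0..2*pi} t * h (rot t y)" for t :: real and y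
  have [measurable]: "(\<lambda>(t, y). H t y) \<in> borel_measurable (lborel \<Otimes>\<^sub>M lborel)"
    unfolding H_def by measurable
  have Hy: "integrable lborel (H t)" for t
    unfolding H_def using lborel_integrable_orthogonal[OF orthogonal_transformation_rot, of h t] h
    by (intro integrable_mult_right) simp
  have Hn: "(\<integral>y. norm (H t y) \<partial>lborel) = indicator {0..2*pi} t * (\<integral>y. \<bar>h y\<bar> \<partial>lborel)" for t
    using lborel_integral_orthogonal[OF orthogonal_transformation_rot, of "\<lambda>y. \<bar>h y\<bar>" t]
    by (simp add: H_def abs_mult)
  have Hi: "(\<integral>y. H t y \<partial>lborel) = indicator {0..2*pi} t * (\<integral>y. h y \<partial>lborel)" for t
    using lborel_integral_orthogonal[OF orthogonal_transformation_rot, of h t]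
    by (simp add: H_def)
  have HP: "integrable (lborel \<Otimes>\<^sub>M lborel) (\<lambda>(t, y). H t y)"
  proof (rule lborel_pair.Fubini_integrable)
    show "integrable lborel (\<lambda>t. \<integral>y. norm (case (t, y) of (t, y) \<Rightarrow> H t y) \<partial>lborel)"
      unfolding prod.case Hn by (intro integrable_mult_left integrable_real_indicator) auto
  qed (use Hy in auto)
  have Ht: "AE y in lborel. (\<integral>t. H t y \<partial>lborel) = 2 * pi * ((ring_ln r y - ln (norm y)) * f y)"
    using AE_norm_neq[of r]
  proof eventually_elim
    case (elim y)
    let ?g = "\<lambda>t. (ln (norm (e - rot t y)) - ln (norm y)) * f y"
    \<comment> \<open>Off the sphere of radius \<open>r\<close> the circle through \<open>y\<close>
      avoids \<open>e\<close>, so the integrand is continuous in \<open>t\<close>.\<close>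
    have "e - rot t y \<noteq> 0" for t
      using elim ne norm_rot[of t y] by auto
    then have "continuous_on {0..2*pi} ?g"
      by (intro continuous_intros continuous_on_rot) auto
    then have "set_integrable lborel {0..2*pi} ?g"
      by (rule borel_integrable_atLeastAtMost')
    then have "(LINT t:{0..2*pi}|lborel. ?g t) = integral {0..2*pi} ?g"
      by (rule set_borel_integral_eq_integral)
    also have "(?g has_integral (2 * pi * ring_ln r y - 2 * pi * ln (norm y)) * f y) {0..2*pi}"
      using has_integral_const_real[of "ln (norm y)" 0 "2 * pi"] elim unfolding e_def
      by (intro has_integral_mult_left has_integral_diff rotation_mean_ln) (auto simp: r_def)
    then have "integral {0..2*pi} ?g = (2 * pi * ring_ln r y - 2 * pi * ln (norm y)) * f y"
      by (rule integral_unique)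
    also have "(LINT t:{0..2*pi}|lborel. ?g t) = (\<integral>t. H t y \<partial>lborel)"
    proof -
      have "f (rot t y) = f y" for t by (rule F(4)) simp
      then show ?thesis
        unfolding set_lebesgue_integral_def H_def h_def by simp
    qed
    finally show ?case by (simp add: algebra_simps)
  qed
  have m: "(\<lambda>y. (ring_ln r y - ln (norm y)) * f y) \<in> borel_measurable lborel"
    unfolding ring_ln_def circ_def by measurable
  have "integrable lborel (\<lambda>y. \<integral>t. H t y \<partial>lborel)"
    by (rule lborel_pair.integrable_snd[OF HP])
  then have "integrable lborel (\<lambda>y. 2 * pi * ((ring_ln r y - ln (norm y)) * f y))"
    by (rule integrable_cong_AE_imp) (use Ht m in \<open>auto simp: eq_commute\<close>)
  then show ?int by (simp add: r_def)
  have "2 * pi * (\<integral>y. h y \<partial>lborel) = (\<integral>t. (\<integral>y. H t y \<partial>lborel) \<partial>lborel)"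
    unfolding Hi by simp
  also have "\<dots> = (\<integral>y. (\<integral>t. H t y \<partial>lborel) \<partial>lborel)"
    by (rule lborel_pair.Fubini_integral[OF HP, symmetric])
  also have "\<dots> = (\<integral>y. 2 * pi * ((ring_ln r y - ln (norm y)) * f y) \<partial>lborel)"
    by (rule integral_cong_AE) (use Ht m in auto)
  also have "\<dots> = 2 * pi * (\<integral>y. (ring_ln r y - ln (norm y)) * f y \<partial>lborel)"
    by simp
  finally show ?eq
    unfolding 1 by (simp add: r_def)
qed

section \<open>Dilating radial potentials\<close>

text \<open>Averaging removes the singularities: this difference of averaged kernels is bounded by
  \<open>\<bar>h\<bar>\<close> uniformly in \<open>x\<close> and \<open>y\<close>, unlike the
  difference of the original ones.\<close>

definition dil :: "real \<Rightarrow> real ^ 'n \<Rightarrow> real ^ 'n \<Rightarrow> real" where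
  "dil h x y = ring_ln (exp h * norm x) y - ring_ln (norm x) y"

definition dil_deriv :: "real ^ 'n \<Rightarrow> real ^ 'n \<Rightarrow> real" where
  "dil_deriv x y = circ_deriv (norm x) (norm y) (plane_sq y)"

definition pot_dil :: "(real ^ 'n \<Rightarrow> real) \<Rightarrow> real \<Rightarrow> real ^ 'n \<Rightarrow> real" where
  "pot_dil f h x = (\<integral>y. dil h x y * f y \<partial>lborel)"

text \<open>For a radial density \<open>f\<close> this is \<open>V'\<^sub>\<mu>\<close> of the
  opening text, by \<open>has_derivative_pot_dil\<close>.\<close>

definition pot_deriv :: "(real ^ 'n \<Rightarrow> real) \<Rightarrow> real ^ 'n \<Rightarrow> real" where
  "pot_deriv f x = (\<integral>y. dil_deriv x y * f y \<partial>lborel)"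

lemma abs_dil_le: "\<bar>dil h x y\<bar> \<le> \<bar>h\<bar>"
  unfolding dil_def ring_ln_def by (rule abs_ln_circ_dilate[OF plane_sq_le norm_ge_zero])

lemma dil_deriv_bounds: "0 \<le> dil_deriv x y" "dil_deriv x y \<le> 1"
  unfolding dil_deriv_def by (rule circ_deriv_bounds[OF plane_sq_le])+

lemma measurable_dil [measurable]:
  "(\<lambda>z. dil h (fst z) (snd z)) \<in> borel_measurable (lborel \<Otimes>\<^sub>M lborel)"
  unfolding dil_def ring_ln_def circ_def by measurable

lemma measurable_dil_deriv [measurable]:
  "(\<lambda>z. dil_deriv (fst z) (snd z)) \<in> borel_measurable (lborel \<Otimes>\<^sub>M lborel)"
  unfolding dil_deriv_def circ_deriv_def by measurable

lemma measurable_dil_snd [measurable]: "dil h x \<in> borel_measurable borel"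
  unfolding dil_def[abs_def] ring_ln_def circ_def by measurable

lemma measurable_dil_deriv_snd [measurable]: "dil_deriv x \<in> borel_measurable borel"
  unfolding dil_deriv_def[abs_def] circ_deriv_def by measurable

lemma has_derivative_dil:
  assumes "norm x \<noteq> norm y"
  shows "((\<lambda>h. dil h x y) has_real_derivative dil_deriv x y) (at 0)"
  unfolding dil_def dil_deriv_def ring_ln_def
  using DERIV_diff[OF has_derivative_ln_circ[OF plane_sq_le norm_ge_zero norm_ge_zero assms] DERIV_const]
  unfolding diff_0_right .

lemma integrable_dil_mult:
  assumes f: "radial_density f"
  shows "integrable lborel (\<lambda>y. dil h x y * f y)"
proof (rule Bochner_Integration.integrable_bound)
  note F = radial_densityD[OF f]
  have [measurable]: "f \<in> borel_measurable borel" by (rule F(2))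
  show "integrable lborel (\<lambda>y. \<bar>h\<bar> * f y)" using F(1) by simp
  show "AE y in lborel. norm (dil h x y * f y) \<le> norm (\<bar>h\<bar> * f y)"
    by (rule AE_I2) (simp add: abs_mult mult_right_mono abs_dil_le)
qed (use radial_densityD(2)[OF f] in measurable)

lemma integrable_dil_deriv_mult:
  assumes f: "radial_density f"
  shows "integrable lborel (\<lambda>y. dil_deriv x y * f y)"
proof (rule Bochner_Integration.integrable_bound)
  note F = radial_densityD[OF f]
  show "integrable lborel f" by (rule F(1))
  show "AE y in lborel. norm (dil_deriv x y * f y) \<le> norm (f y)"
    using dil_deriv_bounds F(3) by (intro AE_I2) (simp add: abs_mult mult_left_le_one_le)
qed (use radial_densityD(2)[OF f] in measurable)

lemma abs_pot_dil_le:
  assumes f: "radial_density f"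
  shows "\<bar>pot_dil f h x\<bar> \<le> \<bar>h\<bar> * (\<integral>y. f y \<partial>lborel)"
proof -
  note F = radial_densityD[OF f]
  have "\<bar>pot_dil f h x\<bar> \<le> (\<integral>y. \<bar>dil h x y * f y\<bar> \<partial>lborel)"
    unfolding pot_dil_def by (rule integral_abs_bound)
  also have "\<dots> \<le> (\<integral>y. \<bar>h\<bar> * f y \<partial>lborel)"
    using F(1,3) by (intro integral_mono integrable_abs integrable_dil_mult[OF f] integrable_mult_right)
      (auto simp: abs_mult intro!: mult_right_mono abs_dil_le)
  finally show ?thesis by simp
qed

lemma pot_deriv_bounds:
  assumes f: "radial_density f"
  shows "0 \<le> pot_deriv f x" "pot_deriv f x \<le> (\<integral>y. f y \<partial>lborel)"
proof -
  note F = radial_densityD[OF f]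
  show "0 \<le> pot_deriv f x"
    unfolding pot_deriv_def using dil_deriv_bounds F(3) by (intro integral_nonneg_AE AE_I2) simp
  show "pot_deriv f x \<le> (\<integral>y. f y \<partial>lborel)"
    unfolding pot_deriv_def using dil_deriv_bounds F(1,3)
    by (intro integral_mono integrable_dil_deriv_mult[OF f]) (simp_all add: mult_left_le_one_le)
qed

lemma borel_measurable_pot_dil [measurable]:
  assumes [measurable]: "f \<in> borel_measurable borel"
  shows "pot_dil f h \<in> borel_measurable borel"
proof -
  have "(\<lambda>x. \<integral>y. dil h x y * f y \<partial>lborel) \<in> borel_measurable lborel"
    by (rule lborel.borel_measurable_lebesgue_integral) measurable
  then show ?thesis unfolding pot_dil_def[abs_def] by simp
qed

lemma borel_measurable_pot_deriv [measurable]: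
  assumes [measurable]: "f \<in> borel_measurable borel"
  shows "pot_deriv f \<in> borel_measurable borel"
proof -
  have "(\<lambda>x. \<integral>y. dil_deriv x y * f y \<partial>lborel) \<in> borel_measurable lborel"
    by (rule lborel.borel_measurable_lebesgue_integral) measurable
  then show ?thesis unfolding pot_deriv_def[abs_def] by simp
qed

section \<open>Dilated logarithmic potentials and their derivatives\<close>

lemma log_potential_dilate:
  assumes f: "radial_density f"
  shows "(\<integral>y. (ln (norm (exp h *\<^sub>R x - y)) - ln (norm y)) * f y \<partial>lborel)
    - (\<integral>y. (ln (norm (x - y)) - ln (norm y)) * f y \<partial>lborel) = pot_dil f h x"
proof -
  have "(\<integral>y. (ln (norm (exp h *\<^sub>R x - y)) - ln (norm y)) * f y \<partial>lborel)
    - (\<integral>y. (ln (norm (x - y)) - ln (norm y)) * f y \<partial>lborel)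
    = (\<integral>y. (ring_ln (norm (exp h *\<^sub>R x)) y - ln (norm y)) * f y
        - (ring_ln (norm x) y - ln (norm y)) * f y \<partial>lborel)"
    unfolding log_potential_eq_ring_ln[OF f]
    by (rule Bochner_Integration.integral_diff[symmetric]) (rule integrable_ring_ln[OF f])+
  also have "\<dots> = pot_dil f h x"
    unfolding pot_dil_def dil_def
    by (rule Bochner_Integration.integral_cong) (simp_all add: algebra_simps)
  finally show ?thesis .
qed

lemma integrable_ln_norm_diff':
  assumes f: "radial_density f"
  shows "integrable lborel (\<lambda>y. (ln (norm (a - y)) - ln (norm (b - y))) * f y)"
  using integrable_ln_norm_diff[OF radial_densityD(1,5)[OF f], of a b]
  by (simp add: norm_minus_commute)

text \<open>The unaveraged kernel returns here because it behaves simply under exchange of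
  \<open>x\<close> and \<open>y\<close>, whereas \<open>dil\<close> treats the two
  asymmetrically.\<close>

lemma pot_dil_eq:
  assumes f: "radial_density f"
  shows "pot_dil f h x = (\<integral>y. (ln (norm (exp h *\<^sub>R x - y)) - ln (norm (x - y))) * f y \<partial>lborel)"
proof -
  have "(\<integral>y. (ln (norm (exp h *\<^sub>R x - y)) - ln (norm y)) * f y \<partial>lborel)
    - (\<integral>y. (ln (norm (x - y)) - ln (norm y)) * f y \<partial>lborel)
    = (\<integral>y. (ln (norm (exp h *\<^sub>R x - y)) - ln (norm y)) * f y
        - (ln (norm (x - y)) - ln (norm y)) * f y \<partial>lborel)"
    using integrable_ln_norm_diff'[OF f, of _ 0]
    by (intro Bochner_Integration.integral_diff[symmetric]) simp_all
  also have "\<dots> = (\<integral>y. (ln (norm (exp h *\<^sub>R x - y)) - ln (norm (x - y))) * f y \<partial>lborel)"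
    by (rule Bochner_Integration.integral_cong) (simp_all add: algebra_simps)
  finally show ?thesis unfolding log_potential_dilate[OF f] .
qed

lemma has_derivative_pot_dil:
  assumes f: "radial_density f"
  shows "((\<lambda>h. pot_dil f h x) has_real_derivative pot_deriv f x) (at 0)"
  unfolding pot_dil_def pot_deriv_def
proof (rule has_derivative_integral_at_0)
  note F = radial_densityD[OF f]
  have [measurable]: "f \<in> borel_measurable borel" by (rule F(2))
  show "(\<lambda>y. dil h x y * f y) \<in> borel_measurable lborel"
    "(\<lambda>y. dil_deriv x y * f y) \<in> borel_measurable lborel" for h by measurable
  show "integrable lborel f" by (rule F(1))
  show "\<bar>dil h x y * f y\<bar> \<le> \<bar>h\<bar> * f y" for h y
    using F(3) by (simp add: abs_mult mult_right_mono abs_dil_le)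
  show "AE y in lborel. ((\<lambda>h. dil h x y * f y) has_real_derivative dil_deriv x y * f y) (at 0)"
    using AE_norm_neq[of "norm x"]
  proof eventually_elim
    case (elim y)
    then have "norm x \<noteq> norm y" by simp
    then show ?case by (rule DERIV_cmult_right[OF has_derivative_dil])
  qed
qed

lemma has_derivative_integral_pot_dil:
  assumes f: "radial_density f" and g: "radial_density g"
  shows "((\<lambda>h. \<integral>x. pot_dil f h x * g x \<partial>lborel) has_real_derivative
    (\<integral>x. pot_deriv f x * g x \<partial>lborel)) (at 0)"
proof (rule has_derivative_integral_at_0)
  note F = radial_densityD[OF f] and G = radial_densityD[OF g]
  have [measurable]: "f \<in> borel_measurable borel" "g \<in> borel_measurable borel" by (rule F(2) G(2))+
  show "(\<lambda>x. pot_dil f h x * g x) \<in> borel_measurable lborel"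
    "(\<lambda>x. pot_deriv f x * g x) \<in> borel_measurable lborel" for h by measurable
  show "integrable lborel (\<lambda>x. (\<integral>y. f y \<partial>lborel) * g x)" using G(1) by simp
  show "\<bar>pot_dil f h x * g x\<bar> \<le> \<bar>h\<bar> * ((\<integral>y. f y \<partial>lborel) * g x)" for h x
    using mult_right_mono[OF abs_pot_dil_le[OF f, of h x] G(3)[of x]] G(3)[of x]
    by (simp add: abs_mult mult.assoc)
  show "AE x in lborel. ((\<lambda>h. pot_dil f h x * g x) has_real_derivative pot_deriv f x * g x) (at 0)"
    by (intro AE_I2 DERIV_cmult_right has_derivative_pot_dil[OF f])
qed

section \<open>The self-interaction identity\<close>

text \<open>
  Exchanging \<open>x\<close> and \<open>y\<close> turns \<open>ln |e\<^sup>h x - y|\<close> into \<open>h + ln |e\<^sup>-\<^sup>h x - y|\<close>. The compact support makes the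
  unaveraged kernel integrable on the product space, so that Fubini applies.
\<close>

lemma integral_pot_deriv_self_compact_support:
  assumes f: "radial_density f" and supp: "\<And>y. R \<le> norm y \<Longrightarrow> f y = 0"
  shows "(\<integral>x. pot_deriv f x * f x \<partial>lborel) = (\<integral>x. f x \<partial>lborel)\<^sup>2 / 2"
proof -
  note F = radial_densityD[OF f]
  have [measurable]: "f \<in> borel_measurable borel" by (rule F(2))
  define \<beta> where "\<beta> = (\<integral>x. f x \<partial>lborel)"
  define N where "N = (\<integral>y. neg_ln (y::real^'n) \<partial>lborel)"
  obtain M0 where M0: "\<And>y. norm y \<le> R \<Longrightarrow> \<bar>f y\<bar> \<le> M0"
    using F(5)[of R] by blast
  define M where "M = \<bar>M0\<bar>"
  have M: "f y \<le> M" for y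
    using M0[of y] supp[of y] by (cases "norm y \<le> R") (auto simp: M_def)
  have "0 \<le> M" by (simp add: M_def)
  define k where "k h x y = (ln (norm (exp h *\<^sub>R x - y)) - ln (norm (x - y))) * f y" for h and x y :: "real ^ 'n"
  define \<Phi> where "\<Phi> h = (\<integral>x. pot_dil f h x * f x \<partial>lborel)" for h
  have [measurable]: "(\<lambda>(x, y). k h x y * f x) \<in> borel_measurable (lborel \<Otimes>\<^sub>M lborel)" for h
    unfolding k_def by measurable
  have ki: "integrable lborel (k h x)" for h x
    unfolding k_def by (rule integrable_ln_norm_diff'[OF f])
  \<comment> \<open>The bound grows linearly in \<open>norm x\<close>, the distance from
    \<open>x\<close> to \<open>exp h *\<^sub>R x\<close> being proportional to it. On the support of
    \<open>f\<close> it becomes a constant, which yields integrability on the product space.\<close>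
  have kb: "(\<integral>y. \<bar>k h x y\<bar> \<partial>lborel) \<le> \<bar>exp h - 1\<bar> * norm x * \<beta> + 2 * M * N" for h x
  proof -
    have i1: "integrable lborel (\<lambda>y. M * neg_ln (y - c))" for c :: "real ^ 'n"
      by (intro integrable_mult_right integrable_neg_ln_diff)
    have i0: "integrable lborel (\<lambda>y. \<bar>exp h - 1\<bar> * norm x * f y)"
      by (intro integrable_mult_right F(1))
    have "(\<integral>y. \<bar>k h x y\<bar> \<partial>lborel)
       \<le> (\<integral>y. \<bar>exp h - 1\<bar> * norm x * f y + (M * neg_ln (y - exp h *\<^sub>R x) + M * neg_ln (y - x)) \<partial>lborel)"
    proof (rule integral_mono)
      show "integrable lborel (\<lambda>y. \<bar>exp h - 1\<bar> * norm x * f y + (M * neg_ln (y - exp h *\<^sub>R x) + M * neg_ln (y - x)))"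
        by (intro Bochner_Integration.integrable_add i0 i1)
      fix y
      have "exp h *\<^sub>R x - x = (exp h - 1) *\<^sub>R x" by (simp add: algebra_simps)
      then have nx: "norm (exp h *\<^sub>R x - x) = \<bar>exp h - 1\<bar> * norm x" by simp
      have "\<bar>k h x y\<bar> = \<bar>ln (norm (y - exp h *\<^sub>R x)) - ln (norm (y - x))\<bar> * f y"
        using F(3)[of y] by (simp add: k_def abs_mult norm_minus_commute)
      also have "\<dots> \<le> (\<bar>exp h - 1\<bar> * norm x + neg_ln (y - exp h *\<^sub>R x) + neg_ln (y - x)) * f y"
        using abs_ln_norm_diff_le[of y "exp h *\<^sub>R x" x] unfolding nx by (rule mult_right_mono) (rule F(3))
      also have "\<dots> \<le> \<bar>exp h - 1\<bar> * norm x * f y + (M * neg_ln (y - exp h *\<^sub>R x) + M * neg_ln (y - x))"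
        using mult_left_mono[OF M[of y] neg_ln_nonneg[of "y - exp h *\<^sub>R x"]]
          mult_left_mono[OF M[of y] neg_ln_nonneg[of "y - x"]]
        by (simp add: algebra_simps)
      finally show "\<bar>k h x y\<bar> \<le> \<bar>exp h - 1\<bar> * norm x * f y + (M * neg_ln (y - exp h *\<^sub>R x) + M * neg_ln (y - x))" .
    qed (use ki in simp)
    also have "\<dots> = \<bar>exp h - 1\<bar> * norm x * \<beta> + (M * N + M * N)"
      by (simp only: Bochner_Integration.integral_add[OF i0 Bochner_Integration.integrable_add[OF i1 i1]]
        Bochner_Integration.integral_add[OF i1 i1] integral_mult_right_zero integral_neg_ln_diff \<beta>_def N_def)
    finally show ?thesis by (simp add: algebra_simps)
  qed
  have KP: "integrable (lborel \<Otimes>\<^sub>M lborel) (\<lambda>(x, y). k h x y * f x)" for h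
  proof (rule lborel_pair.Fubini_integrable)
    let ?C = "\<bar>exp h - 1\<bar> * R * \<beta> + 2 * M * N"
    show "integrable lborel (\<lambda>x. \<integral>y. norm (case (x, y) of (x, y) \<Rightarrow> k h x y * f x) \<partial>lborel)"
    proof (rule Bochner_Integration.integrable_bound)
      show "integrable lborel (\<lambda>x. ?C * f x)" using F(1) by simp
      show "AE x in lborel. norm (\<integral>y. norm (case (x, y) of (x, y) \<Rightarrow> k h x y * f x) \<partial>lborel) \<le> norm (?C * f x)"
      proof (rule AE_I2)
        fix x
        have "\<beta> \<ge> 0" unfolding \<beta>_def using F(3) by (intro integral_nonneg_AE AE_I2)
        have "norm (\<integral>y. norm (k h x y * f x) \<partial>lborel) = (\<integral>y. \<bar>k h x y\<bar> \<partial>lborel) * f x"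
          using F(3)[of x] by (simp add: abs_mult)
        also have "\<dots> \<le> (\<bar>exp h - 1\<bar> * norm x * \<beta> + 2 * M * N) * f x"
          by (rule mult_right_mono[OF kb F(3)])
        also have "\<dots> \<le> ?C * f x"
        proof (cases "R \<le> norm x")
          case False
          then show ?thesis
            using \<open>\<beta> \<ge> 0\<close> by (intro mult_right_mono add_mono mult_left_mono order_refl F(3)) auto
        qed (simp add: supp)
        also have "\<dots> \<le> norm (?C * f x)" unfolding real_norm_def by (rule abs_ge_self)
        finally show "norm (\<integral>y. norm (case (x, y) of (x, y) \<Rightarrow> k h x y * f x) \<partial>lborel) \<le> norm (?C * f x)"
          by (simp only: prod.case)
      qed
    qed measurable
  qed (use ki in auto)
  have \<Phi>: "\<Phi> h = (\<integral>x. (\<integral>y. k h x y * f x \<partial>lborel) \<partial>lborel)" for h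
    unfolding \<Phi>_def k_def pot_dil_eq[OF f] by simp
  have sym: "\<Phi> h = h * \<beta>\<^sup>2 + \<Phi> (- h)" for h
  proof -
    have "\<Phi> h = (\<integral>y. (\<integral>x. k h x y * f x \<partial>lborel) \<partial>lborel)"
      unfolding \<Phi> by (rule lborel_pair.Fubini_integral[OF KP, symmetric])
    also have "\<dots> = (\<integral>x. (h * \<beta> + pot_dil f (- h) x) * f x \<partial>lborel)"
    proof (rule Bochner_Integration.integral_cong[OF refl])
      fix x
      have "(\<integral>y. k h y x * f y \<partial>lborel) = (\<integral>y. f x * (h * f y + k (- h) x y) \<partial>lborel)"
      proof (rule integral_cong_AE)
        show "AE y in lborel. k h y x * f y = f x * (h * f y + k (- h) x y)"
          \<comment> \<open>At the removed point both distances vanish, and the identity of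
            logarithms would fail because \<open>ln 0 = 0\<close>.\<close>
          using AE_lborel_singleton[of "exp (- h) *\<^sub>R x"]
        proof eventually_elim
          case (elim y)
          have "exp h *\<^sub>R y - x = exp h *\<^sub>R (y - exp (- h) *\<^sub>R x)"
            by (simp add: scaleR_diff_right exp_minus)
          then have "norm (exp h *\<^sub>R y - x) = exp h * norm (exp (- h) *\<^sub>R x - y)"
            by (simp add: norm_minus_commute)
          then have "ln (norm (exp h *\<^sub>R y - x)) = h + ln (norm (exp (- h) *\<^sub>R x - y))"
            using elim by (simp add: ln_mult_pos)
          then show ?case
            unfolding k_def by (simp add: norm_minus_commute[of y x] algebra_simps)
        qed
      qed (unfold k_def, measurable)
      also have "\<dots> = f x * (h * \<beta> + (\<integral>y. k (- h) x y \<partial>lborel))"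
        using F(1) ki[of "- h" x] by (simp add: \<beta>_def)
      finally show "(\<integral>y. k h y x * f y \<partial>lborel) = (h * \<beta> + pot_dil f (- h) x) * f x"
        by (simp add: pot_dil_eq[OF f] k_def)
    qed
    also have "\<dots> = (\<integral>x. h * \<beta> * f x + pot_dil f (- h) x * f x \<partial>lborel)"
      by (simp add: distrib_right)
    also have "\<dots> = h * \<beta> * \<beta> + \<Phi> (- h)"
    proof -
      have "integrable lborel (\<lambda>x. pot_dil f (- h) x * f x)"
      proof (rule Bochner_Integration.integrable_bound)
        show "integrable lborel (\<lambda>x. \<bar>h\<bar> * \<beta> * f x)" using F(1) by simp
        show "AE x in lborel. norm (pot_dil f (- h) x * f x) \<le> norm (\<bar>h\<bar> * \<beta> * f x)"
        proof (rule AE_I2)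
          fix x
          have "norm (pot_dil f (- h) x * f x) \<le> \<bar>h\<bar> * \<beta> * f x"
            using mult_right_mono[OF abs_pot_dil_le[OF f, of "- h" x] F(3)[of x]] F(3)[of x]
            by (simp add: abs_mult \<beta>_def)
          also have "\<dots> \<le> norm (\<bar>h\<bar> * \<beta> * f x)" unfolding real_norm_def by (rule abs_ge_self)
          finally show "norm (pot_dil f (- h) x * f x) \<le> norm (\<bar>h\<bar> * \<beta> * f x)" .
        qed
      qed measurable
      then show ?thesis using F(1) by (simp add: \<beta>_def \<Phi>_def)
    qed
    finally show ?thesis by (simp add: power2_eq_square)
  qed
  define d where "d = (\<integral>x. pot_deriv f x * f x \<partial>lborel)"
  have d: "(\<Phi> has_real_derivative d) (at 0)"
    unfolding \<Phi>_def[abs_def] d_def by (rule has_derivative_integral_pot_dil[OF f f])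
  then have "((\<lambda>h. \<Phi> (- h)) has_real_derivative d * (- 1)) (at 0)"
    by (intro DERIV_chain2[where f = \<Phi> and g = uminus]) (auto intro!: derivative_eq_intros)
  \<comment> \<open>Differentiating \<open>sym\<close> at \<open>0\<close> gives
    \<open>d = \<beta>\<^sup>2 - d\<close>.\<close>
  then have "((\<lambda>h. h * \<beta>\<^sup>2 + \<Phi> (- h)) has_real_derivative 1 * \<beta>\<^sup>2 + d * (- 1)) (at 0)"
    by (intro DERIV_add DERIV_cmult_right DERIV_ident)
  then have "(\<Phi> has_real_derivative 1 * \<beta>\<^sup>2 + d * (- 1)) (at 0)"
    unfolding sym[symmetric] .
  from DERIV_unique[OF d this] show ?thesis
    unfolding d_def \<beta>_def by simp
qed

text \<open>Truncation to growing balls reduces to compact support. Since \<open>dil_deriv\<close>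
  lies between \<open>0\<close> and \<open>1\<close>, dominated convergence applies to the inner and
  then to the outer integral.\<close>

lemma integral_pot_deriv_self:
  assumes f: "radial_density f"
  shows "(\<integral>x. pot_deriv f x * f x \<partial>lborel) = (\<integral>x. f x \<partial>lborel)\<^sup>2 / 2"
proof -
  note F = radial_densityD[OF f]
  have [measurable]: "f \<in> borel_measurable borel" by (rule F(2))
  define g where "g k x = indicator (ball 0 (real k)) x * f x" for k :: nat and x
  have g: "radial_density (g k)" for k
    unfolding g_def by (rule radial_density_truncate[OF f])
  have [measurable]: "g k \<in> borel_measurable borel" for k
    by (rule radial_densityD(2)[OF g])
  have g_le: "0 \<le> g k x" "g k x \<le> f x" for k x
    using F(3)[of x] by (auto simp: g_def indicator_def)
  have g_lim: "(\<lambda>k. g k x) \<longlonglongrightarrow> f x" for x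
  proof (rule tendsto_eventually)
    obtain k0 :: nat where "norm x < real k0" using reals_Archimedean2 by blast
    then have "g k x = f x" if "k0 \<le> k" for k
      using that by (auto simp: g_def indicator_def)
    then show "\<forall>\<^sub>F k in sequentially. g k x = f x"
      by (auto simp: eventually_sequentially)
  qed
  have int_lim: "(\<lambda>k. \<integral>x. g k x \<partial>lborel) \<longlonglongrightarrow> (\<integral>x. f x \<partial>lborel)"
  proof (rule integral_dominated_convergence[where w = f])
    show "AE x in lborel. (\<lambda>k. g k x) \<longlonglongrightarrow> f x" by (intro AE_I2 g_lim)
    show "AE x in lborel. norm (g k x) \<le> f x" for k
      using g_le by (intro AE_I2) simp
  qed (use F(1) in measurable)
  have pot_lim: "(\<lambda>k. pot_deriv (g k) x) \<longlonglongrightarrow> pot_deriv f x" for x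
    unfolding pot_deriv_def
  proof (rule integral_dominated_convergence[where w = f])
    show "AE y in lborel. (\<lambda>k. dil_deriv x y * g k y) \<longlonglongrightarrow> dil_deriv x y * f y"
      by (intro AE_I2 tendsto_mult_left g_lim)
    show "AE y in lborel. norm (dil_deriv x y * g k y) \<le> f y" for k
    proof (rule AE_I2)
      fix y
      have "dil_deriv x y * g k y \<le> 1 * f y"
        using dil_deriv_bounds g_le by (intro mult_mono) auto
      then show "norm (dil_deriv x y * g k y) \<le> f y"
        using dil_deriv_bounds(1)[of x y] g_le(1)[of k y] by simp
    qed
  qed (use F(1) in measurable)
  have "(\<lambda>k. \<integral>x. pot_deriv (g k) x * g k x \<partial>lborel) \<longlonglongrightarrow> (\<integral>x. pot_deriv f x * f x \<partial>lborel)"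
  proof (rule integral_dominated_convergence[where w = "\<lambda>x. (\<integral>y. f y \<partial>lborel) * f x"])
    show "AE x in lborel. (\<lambda>k. pot_deriv (g k) x * g k x) \<longlonglongrightarrow> pot_deriv f x * f x"
      by (intro AE_I2 tendsto_mult g_lim pot_lim)
    show "AE x in lborel. norm (pot_deriv (g k) x * g k x) \<le> (\<integral>y. f y \<partial>lborel) * f x" for k
    proof (rule AE_I2)
      fix x
      have "(\<integral>y. g k y \<partial>lborel) \<le> (\<integral>y. f y \<partial>lborel)"
        using g_le(2) by (intro integral_mono F(1) radial_densityD(1)[OF g])
      then have "pot_deriv (g k) x \<le> (\<integral>y. f y \<partial>lborel)"
        using pot_deriv_bounds(2)[OF g, of k x] by linarith
      then have "pot_deriv (g k) x * g k x \<le> (\<integral>y. f y \<partial>lborel) * f x"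
        using pot_deriv_bounds[OF f, of x] g_le by (intro mult_mono) auto
      then show "norm (pot_deriv (g k) x * g k x) \<le> (\<integral>y. f y \<partial>lborel) * f x"
        using pot_deriv_bounds(1)[OF g, of k x] g_le(1)[of k x] by simp
    qed
    show "integrable lborel (\<lambda>x. (\<integral>y. f y \<partial>lborel) * f x)" using F(1) by simp
  qed measurable
  moreover have lim: "(\<lambda>k. (\<integral>x. g k x \<partial>lborel)\<^sup>2 / 2) \<longlonglongrightarrow> (\<integral>x. f x \<partial>lborel)\<^sup>2 / 2"
    by (intro tendsto_intros int_lim) simp
  moreover have "(\<integral>x. pot_deriv (g k) x * g k x \<partial>lborel) = (\<integral>x. g k x \<partial>lborel)\<^sup>2 / 2" for k
    by (rule integral_pot_deriv_self_compact_support[OF g, of "real k"]) (simp add: g_def)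
  ultimately have "(\<lambda>k. (\<integral>x. g k x \<partial>lborel)\<^sup>2 / 2) \<longlonglongrightarrow> (\<integral>x. pot_deriv f x * f x \<partial>lborel)"
    by (simp only:)
  from LIMSEQ_unique[OF this lim] show ?thesis .
qed

lemma pot_deriv_add:
  assumes f: "radial_density f" and g: "radial_density g"
  shows "pot_deriv (\<lambda>y. f y + g y) x = pot_deriv f x + pot_deriv g x"
  unfolding pot_deriv_def distrib_left
  by (rule Bochner_Integration.integral_add) (rule integrable_dil_deriv_mult f g)+

lemma integrable_pot_deriv_mult:
  assumes f: "radial_density f" and g: "radial_density g"
  shows "integrable lborel (\<lambda>x. pot_deriv f x * g x)"
proof (rule Bochner_Integration.integrable_bound)
  note F = radial_densityD[OF f] and G = radial_densityD[OF g]
  show "integrable lborel (\<lambda>x. (\<integral>y. f y \<partial>lborel) * g x)" using G(1) by simp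
  show "AE x in lborel. norm (pot_deriv f x * g x) \<le> norm ((\<integral>y. f y \<partial>lborel) * g x)"
  proof (rule AE_I2)
    fix x
    have "\<bar>pot_deriv f x\<bar> \<le> \<bar>\<integral>y. f y \<partial>lborel\<bar>"
      using pot_deriv_bounds[OF f, of x] by linarith
    then show "norm (pot_deriv f x * g x) \<le> norm ((\<integral>y. f y \<partial>lborel) * g x)"
      unfolding real_norm_def abs_mult by (rule mult_right_mono) simp
  qed
qed (use radial_densityD(2)[OF f] radial_densityD(2)[OF g] in measurable)

text \<open>The kernel \<open>dil_deriv x y\<close> is at least \<open>1 / 2\<close> for
  \<open>norm y \<le> norm x\<close>, so the mass of \<open>f\<close> near the origin makes
  \<open>pot_deriv f x\<close> positive for \<open>x \<noteq> 0\<close>. The origin is excepted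
  because the weight of \<open>\<mu>\<^sub>1\<close> vanishes there.\<close>

lemma integral_pot_deriv_pos:
  assumes f: "radial_density f" and g: "radial_density g"
    and fpos: "\<And>x. x \<noteq> 0 \<Longrightarrow> 0 < f x" and gpos: "\<And>x. x \<noteq> 0 \<Longrightarrow> 0 < g x"
  shows "0 < (\<integral>x. pot_deriv f x * g x \<partial>lborel)"
proof -
  note F = radial_densityD[OF f] and G = radial_densityD[OF g]
  have not_null: "\<not> (AE x in lborel. x \<notin> ball (0::real^'n) r)" if "0 < r" for r
  proof
    assume "AE x in lborel. x \<notin> ball (0::real^'n) r"
    then have "ball (0::real^'n) r \<in> null_sets lborel"
      by (subst AE_iff_null_sets) auto
    then have "emeasure lborel (ball (0::real^'n) r) = 0"
      by (rule null_setsD1)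
    then show False
      using content_ball_pos[OF that, of "0::real^'n"] by (simp add: measure_def)
  qed
  have pos: "0 < (\<integral>x. q x \<partial>lborel)"
    if q: "integrable lborel q" "\<And>x. 0 \<le> q x" "\<And>x. x \<noteq> 0 \<Longrightarrow> norm x < r \<Longrightarrow> 0 < q x" "0 < r"
    for q :: "real ^ 'n \<Rightarrow> real" and r
  proof (rule ccontr)
    assume "\<not> 0 < (\<integral>x. q x \<partial>lborel)"
    moreover have "0 \<le> (\<integral>x. q x \<partial>lborel)" using q(2) by (intro integral_nonneg_AE AE_I2)
    ultimately have "(\<integral>x. q x \<partial>lborel) = 0" by simp
    then have "AE x in lborel. q x = 0"
      using integral_nonneg_eq_0_iff_AE[OF q(1)] q(2) by simp
    then have "AE x in lborel. x \<notin> ball (0::real^'n) r"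
      using AE_lborel_singleton[of "0::real^'n"]
    proof eventually_elim
      case (elim x)
      then show ?case using q(3)[of x] by auto
    qed
    with not_null[OF q(4)] show False by blast
  qed
  have "0 < pot_deriv f x" if "x \<noteq> 0" for x
    unfolding pot_deriv_def
  proof (rule pos[where r = "norm x"])
    fix y :: "real ^ 'n" assume y: "y \<noteq> 0" "norm y < norm x"
    have "1 / 2 \<le> dil_deriv x y"
      unfolding dil_deriv_def using y by (intro circ_deriv_ge_half plane_sq_le) auto
    then show "0 < dil_deriv x y * f y"
      using fpos[OF y(1)] by simp
  qed (use that integrable_dil_deriv_mult[OF f] dil_deriv_bounds F(3) in auto)
  then show ?thesis
    using pot_deriv_bounds(1)[OF f] G(3) gpos
    by (intro pos[where r = 1] integrable_pot_deriv_mult[OF f g]) auto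
qed

text \<open>One statement serves both measures: \<open>m\<close> is the degree of homogeneity of the
  weight \<open>wt\<close>, which is \<open>0\<close> for \<open>\<mu>\<^sub>0\<close> and
  \<open>n * p\<close> for \<open>\<mu>\<^sub>1\<close>.\<close>

lemma integral_pot_deriv_dilation:
  fixes u wt :: "real ^ 'n \<Rightarrow> real" and c m :: real
  defines "N \<equiv> real CARD('n)"
  defines "g \<equiv> \<lambda>x. c * (wt x * exp (N * u x))"
  assumes f: "radial_density f" and g: "radial_density g"
    and [measurable]: "u \<in> borel_measurable borel" "wt \<in> borel_measurable borel"
    and u: "\<And>h x. u (exp h *\<^sub>R x) = u x - pot_dil f h x"
    and wt: "\<And>h x. wt (exp h *\<^sub>R x) = exp (m * h) * wt x"
  shows "(\<integral>x. pot_deriv f x * g x \<partial>lborel) = (1 + m / N) * (\<integral>x. g x \<partial>lborel)"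
proof -
  note F = radial_densityD[OF f] and G = radial_densityD[OF g]
  have [measurable]: "f \<in> borel_measurable borel" "g \<in> borel_measurable borel" by (rule F(2) G(2))+
  define \<beta> where "\<beta> = (\<integral>x. f x \<partial>lborel)"
  define B where "B = (\<integral>x. g x \<partial>lborel)"
  define \<Phi> where "\<Phi> h = (\<integral>x. pot_dil f h x * g x \<partial>lborel)" for h
  define d where "d = (\<integral>x. pot_deriv f x * g x \<partial>lborel)"
  have N: "0 < N" by (simp add: N_def)
  have \<Phi>': "(\<Phi> has_real_derivative d) (at 0)"
    unfolding \<Phi>_def[abs_def] d_def by (rule has_derivative_integral_pot_dil[OF f g])
  have pg: "integrable lborel (\<lambda>x. pot_dil f h x * g x)" for h
  proof (rule Bochner_Integration.integrable_bound)
    show "integrable lborel (\<lambda>x. \<bar>h\<bar> * \<beta> * g x)" using G(1) by simp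
    show "AE x in lborel. norm (pot_dil f h x * g x) \<le> norm (\<bar>h\<bar> * \<beta> * g x)"
    proof (rule AE_I2)
      fix x
      have "norm (pot_dil f h x * g x) \<le> \<bar>h\<bar> * \<beta> * g x"
        using mult_right_mono[OF abs_pot_dil_le[OF f, of h x] G(3)[of x]] G(3)[of x]
        by (simp add: abs_mult \<beta>_def)
      also have "\<dots> \<le> norm (\<bar>h\<bar> * \<beta> * g x)" unfolding real_norm_def by (rule abs_ge_self)
      finally show "norm (pot_dil f h x * g x) \<le> norm (\<bar>h\<bar> * \<beta> * g x)" .
    qed
  qed measurable
  have le: "0 \<le> exp (- (m + N) * h) * B - B + N * \<Phi> h" for h
  proof -
    \<comment> \<open>The prefactor cancels the growth of the weight, leaving only the change of the
      potential in the exponent.\<close>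
    have gh: "exp (- m * h) * g (exp h *\<^sub>R x) = g x * exp (- N * pot_dil f h x)" for x
    proof -
      have "exp (- m * h) * g (exp h *\<^sub>R x)
         = (exp (- m * h) * exp (m * h)) * (c * (wt x * exp (N * u x + - N * pot_dil f h x)))"
        unfolding g_def u wt by (simp add: algebra_simps)
      also have "exp (- m * h) * exp (m * h) = 1" by (simp add: exp_minus)
      finally show ?thesis unfolding g_def exp_add by simp
    qed
    have "B - N * \<Phi> h = (\<integral>x. g x - N * (pot_dil f h x * g x) \<partial>lborel)"
      using G(1) pg[of h] by (simp add: B_def \<Phi>_def)
    also have "\<dots> \<le> (\<integral>x. exp (- m * h) * g (exp h *\<^sub>R x) \<partial>lborel)"
    proof (rule integral_mono)
      show "integrable lborel (\<lambda>x. g x - N * (pot_dil f h x * g x))"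
        using G(1) pg[of h] by simp
      show "integrable lborel (\<lambda>x. exp (- m * h) * g (exp h *\<^sub>R x))"
        unfolding gh
      proof (rule Bochner_Integration.integrable_bound)
        show "integrable lborel (\<lambda>x. exp (N * (\<bar>h\<bar> * \<beta>)) * g x)" using G(1) by simp
        show "AE x in lborel. norm (g x * exp (- N * pot_dil f h x)) \<le> norm (exp (N * (\<bar>h\<bar> * \<beta>)) * g x)"
        proof (rule AE_I2)
          fix x
          have "- pot_dil f h x \<le> \<bar>h\<bar> * \<beta>"
            using abs_pot_dil_le[OF f, of h x] unfolding \<beta>_def by linarith
          from mult_left_mono[OF this less_imp_le[OF N]]
          have "exp (- N * pot_dil f h x) \<le> exp (N * (\<bar>h\<bar> * \<beta>))" by simp
          from mult_right_mono[OF this G(3)[of x]] G(3)[of x]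
          show "norm (g x * exp (- N * pot_dil f h x)) \<le> norm (exp (N * (\<bar>h\<bar> * \<beta>)) * g x)"
            by (simp add: abs_mult mult.commute)
        qed
      qed measurable
      fix x
      have "g x * (1 + - N * pot_dil f h x) \<le> g x * exp (- N * pot_dil f h x)"
        using exp_ge_add_one_self G(3) by (rule mult_left_mono)
      then show "g x - N * (pot_dil f h x * g x) \<le> exp (- m * h) * g (exp h *\<^sub>R x)"
        unfolding gh by (simp add: algebra_simps)
    qed
    also have "\<dots> = exp (- m * h) * (B / exp h ^ CARD('n))"
      using lborel_integral_scaleR[of "exp h" g] by (simp add: B_def)
    also have "\<dots> = exp (- m * h) * exp (- N * h) * B"
      by (simp add: N_def exp_of_nat_mult[symmetric] exp_minus divide_inverse)
    also have "\<dots> = exp (- (m + N) * h) * B"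
      by (simp add: exp_add[symmetric] algebra_simps)
    finally show ?thesis by simp
  qed
  have "\<Phi> 0 = 0"
    using abs_pot_dil_le[OF f, of 0] by (simp add: \<Phi>_def)
  moreover have "((\<lambda>h. exp (- (m + N) * h) * B - B + N * \<Phi> h) has_real_derivative
     (- (m + N) * B + N * d)) (at 0)"
  proof -
    have "((\<lambda>h. exp (- (m + N) * h) * B - B) has_real_derivative (- (m + N) * B)) (at 0)"
      by (auto intro!: derivative_eq_intros)
    from DERIV_add[OF this DERIV_cmult[OF \<Phi>', of N]] show ?thesis .
  qed
  \<comment> \<open>The nonnegative function in \<open>le\<close> vanishes at \<open>h = 0\<close>,
    so it has a minimum there and zero derivative. Nonnegativity holds for all \<open>h\<close>,
    hence any neighbourhood radius would do in place of \<open>1\<close>.\<close>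
  ultimately have "- (m + N) * B + N * d = 0"
    using le by (intro DERIV_local_min[where d = 1]) auto
  then show ?thesis
    using N unfolding d_def[symmetric] B_def[symmetric] by (simp add: field_simps)
qed

end

section \<open>The Pohozaev identity and the resulting bounds\<close>

theorem theorem8p1:
  fixes u :: "real ^ 'n \<Rightarrow> real" and n :: nat and p C \<beta> :: real
  assumes "n = CARD('n)" and "n \<ge> 2" and "even n" and "p > 0"
    and "radially_symmetric u" and "continuous_on UNIV u"
    and "integrable lborel (\<lambda>x. (1 + norm x powr (real n * p)) * exp (real n * u x))"
    and "\<And>x. u x = 2 / (fact (n - 1) * sphere_volume TYPE('n)) *
           (\<integral>y. ln (norm y / norm (x - y)) *
                ((1 + norm y powr (real n * p)) * exp (real n * u y)) \<partial>lborel) + C"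
    and "\<beta> = 2 / (fact (n - 1) * sphere_volume TYPE('n)) *
           (\<integral>x. (1 + norm x powr (real n * p)) * exp (real n * u x) \<partial>lborel)"
  shows "max 2 (2 * p) < \<beta> \<and> \<beta> < 2 + 2 * p"
proof -
  note n = assms(1,2) and p = assms(4) and rad = assms(5) and cont = assms(6)
  define c where "c = 2 / (fact (n - 1) * sphere_volume TYPE('n))"
  have c: "0 < c"
    unfolding c_def sphere_volume_eq by (simp add: Gamma_real_pos add_pos_nonneg)
  have "\<exists>i j :: 'n. i \<noteq> j"
  proof (rule ccontr)
    assume "\<not> (\<exists>i j :: 'n. i \<noteq> j)"
    then have "UNIV = {undefined :: 'n}" by auto
    then have "CARD('n) = 1" by (metis card_1_singleton_iff One_nat_def)
    then show False using n by simp
  qed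
  then obtain i j :: 'n where "i \<noteq> j" by blast
  then interpret coord_plane i j by unfold_locales

  let ?n = "real CARD('n)"
  have [measurable]: "u \<in> borel_measurable borel"
    using cont by (rule borel_measurable_continuous_onI)
  define wt where "wt q x = (if q then norm x powr (?n * p) else 1)" for q and x :: "real ^ 'n"
  \<comment> \<open>\<open>f False\<close> and \<open>f True\<close> are the densities of \<open>\<mu>\<^sub>0\<close> and \<open>\<mu>\<^sub>1\<close>\<close>
  define f where "f q x = c * (wt q x * exp (?n * u x))" for q x
  have [measurable]: "wt q \<in> borel_measurable borel" for q
    unfolding wt_def[abs_def] by (cases q) simp_all
  have [measurable]: "f q \<in> borel_measurable borel" for q
    unfolding f_def[abs_def] by measurable
  have wt0: "0 \<le> wt q x" for q x by (simp add: wt_def)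
  have fsum: "c * ((1 + norm x powr (real n * p)) * exp (real n * u x)) = f False x + f True x" for x
    by (simp add: f_def wt_def n algebra_simps)
  have rd: "radial_density (f q)" for q
    unfolding radial_density_def
  proof (intro conjI allI)
    show "0 \<le> f q y" for y using c wt0 by (simp add: f_def)
    show "integrable lborel (f q)"
    proof (rule Bochner_Integration.integrable_bound)
      show "integrable lborel (\<lambda>x. c * ((1 + norm x powr (real n * p)) * exp (real n * u x)))"
        using assms(7) by (rule integrable_mult_right)
      show "AE x in lborel. norm (f q x) \<le> norm (c * ((1 + norm x powr (real n * p)) * exp (real n * u x)))"
        unfolding fsum using c wt0 by (intro AE_I2) (cases q; simp add: f_def)
    qed measurable
    show "radially_symmetric (f q)"
      using rad unfolding radially_symmetric_def f_def wt_def by metis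
    fix R
    \<comment> \<open>Positivity of the exponent makes the weight continuous at the origin, so
      \<open>f q\<close> is bounded on balls.\<close>
    have ne: "0 < ?n * p" using p by simp
    have "continuous_on UNIV (f q)"
      unfolding f_def wt_def using ne cont
      by (cases q) (auto intro!: continuous_intros continuous_on_powr')
    then have "compact (f q ` cball 0 R)"
      by (intro compact_continuous_image compact_cball) (rule continuous_on_subset, auto)
    then obtain M where "\<forall>z\<in>f q ` cball 0 R. norm z \<le> M"
      using compact_imp_bounded bounded_iff by blast
    then show "\<exists>M. \<forall>y. norm y \<le> R \<longrightarrow> \<bar>f q y\<bar> \<le> M"
      by (intro exI[of _ M]) auto
  qed
  define F where "F x = f False x + f True x" for x
  have F: "radial_density F"
    unfolding F_def[abs_def] by (intro radial_density_add rd)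
  have u_eq: "u x = C - (\<integral>y. (ln (norm (x - y)) - ln (norm y)) * F y \<partial>lborel)" for x
  proof -
    have "c * (\<integral>y. ln (norm y / norm (x - y)) *
                ((1 + norm y powr (real n * p)) * exp (real n * u y)) \<partial>lborel)
        = (\<integral>y. ln (norm y / norm (x - y)) * (c * ((1 + norm y powr (real n * p)) * exp (real n * u y))) \<partial>lborel)"
      unfolding integral_mult_right_zero[symmetric] by (simp only: mult.left_commute)
    also have "\<dots> = (\<integral>y. - ((ln (norm (x - y)) - ln (norm y)) * F y) \<partial>lborel)"
    proof (rule integral_cong_AE)
      show "AE y in lborel. ln (norm y / norm (x - y)) * (c * ((1 + norm y powr (real n * p)) * exp (real n * u y)))
          = - ((ln (norm (x - y)) - ln (norm y)) * F y)"
        \<comment> \<open>The logarithm of the quotient splits only away from \<open>y = 0\<close>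
          and \<open>y = x\<close>, where one of the norms vanishes.\<close>
        using AE_lborel_singleton[of 0] AE_lborel_singleton[of x]
      proof eventually_elim
        case (elim y)
        then show ?case
          unfolding fsum F_def[symmetric] by (simp add: ln_div algebra_simps)
      qed
    qed (unfold fsum F_def, measurable)
    finally show ?thesis
      using assms(8)[of x] unfolding c_def[symmetric] by simp
  qed
  have u_dil: "u (exp h *\<^sub>R x) = u x - pot_dil F h x" for h x
    using log_potential_dilate[OF F, of h x] unfolding u_eq[of x] u_eq[of "exp h *\<^sub>R x"] by simp
  define b where "b q = (\<integral>x. f q x \<partial>lborel)" for q
  have wt_dil: "wt q (exp h *\<^sub>R x) = exp ((if q then ?n * p else 0) * h) * wt q x" for q h x
    by (simp add: wt_def powr_mult exp_powr_real mult.commute)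
  have pd: "(\<integral>x. pot_deriv F x * f q x \<partial>lborel) = (1 + (if q then ?n * p else 0) / ?n) * b q" for q
    unfolding b_def f_def
    by (rule integral_pot_deriv_dilation[OF F _ _ _ u_dil wt_dil]) (use rd[of q] in \<open>simp_all add: f_def[abs_def]\<close>)
  have \<beta>_eq: "\<beta> = b False + b True"
  proof -
    have "\<beta> = (\<integral>x. f False x + f True x \<partial>lborel)"
      using assms(9) unfolding c_def[symmetric] integral_mult_right_zero[symmetric] fsum .
    then show ?thesis
      using radial_densityD(1)[OF rd] by (simp add: b_def)
  qed
  have fpos: "0 < f q x" if "x \<noteq> 0" for q x
    using that c by (simp add: f_def wt_def)
  have bpos: "0 < b q" for q
  proof -
    \<comment> \<open>The self-interaction is \<open>(b q)\<^sup>2 / 2\<close>, so its positivity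
      rules out zero mass.\<close>
    have "0 < (\<integral>x. pot_deriv (f q) x * f q x \<partial>lborel)"
      by (intro integral_pot_deriv_pos rd fpos)
    then have "b q \<noteq> 0" unfolding integral_pot_deriv_self[OF rd] by (auto simp: b_def)
    moreover have "0 \<le> b q"
      unfolding b_def using radial_densityD(3)[OF rd] by (intro integral_nonneg_AE AE_I2)
    ultimately show ?thesis by simp
  qed
  have pd0: "(\<integral>x. pot_deriv F x * f False x \<partial>lborel) = b False"
    and pd1: "(\<integral>x. pot_deriv F x * f True x \<partial>lborel) = (1 + p) * b True"
    unfolding pd by simp_all
  have "(\<integral>x. F x \<partial>lborel) = \<beta>"
    unfolding F_def \<beta>_eq b_def using radial_densityD(1)[OF rd] by simp
  then have "\<beta>\<^sup>2 / 2 = (\<integral>x. pot_deriv F x * F x \<partial>lborel)"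
    using integral_pot_deriv_self[OF F] by simp
  also have "\<dots> = b False + (1 + p) * b True"
    unfolding pd0[symmetric] pd1[symmetric] F_def[of x for x] distrib_left
    by (intro Bochner_Integration.integral_add integrable_pot_deriv_mult radial_density_add rd)
  finally have poh: "\<beta>\<^sup>2 / 2 = \<beta> + p * b True"
    by (simp add: \<beta>_eq algebra_simps)
  have "b False = (\<integral>x. pot_deriv (f False) x * f False x \<partial>lborel) + (\<integral>x. pot_deriv (f True) x * f False x \<partial>lborel)"
    unfolding pd0[symmetric] F_def[abs_def] pot_deriv_add[OF rd rd] distrib_right
    by (intro Bochner_Integration.integral_add integrable_pot_deriv_mult rd)
  \<comment> \<open>The cross term is strictly positive and is dropped.\<close>
  then have "(b False)\<^sup>2 / 2 < b False"
    unfolding integral_pot_deriv_self[OF rd] b_def[symmetric] using integral_pot_deriv_pos[OF rd rd fpos fpos, of True False] by linarith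
  then have b2: "b False < 2"
    using bpos[of False] by (simp add: power2_eq_square)
  have \<beta>0: "0 < \<beta>" using bpos by (simp add: \<beta>_eq add_pos_pos)
  have pb: "0 < p * b True" "p * b True < p * \<beta>" "p * b False < p * 2"
    using p bpos b2 by (simp_all add: \<beta>_eq)
  have "\<beta> * 2 < \<beta> * \<beta>" using poh pb by (simp add: power2_eq_square)
  then have "2 < \<beta>" using \<beta>0 by simp
  moreover have "\<beta> * \<beta> < \<beta> * (2 + 2 * p)"
    using poh pb by (simp add: power2_eq_square algebra_simps)
  then have "\<beta> < 2 + 2 * p" using \<beta>0 by simp
  \<comment> \<open>Substituting \<open>b True = \<beta> - b False\<close> in \<open>poh\<close>
    gives \<open>\<beta>\<^sup>2 = 2 * \<beta> + 2 * p * (\<beta> - b False)\<close>. The product is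
    then positive by \<open>b2\<close>, and its first factor is already known to be
    positive.\<close>
  moreover have "(\<beta> - 2) * (\<beta> - 2 * p) = 2 * (p * 2 - p * b False)"
    using poh by (simp add: \<beta>_eq power2_eq_square algebra_simps)
  then have "0 < (\<beta> - 2) * (\<beta> - 2 * p)" using pb by simp
  then have "2 * p < \<beta>" using \<open>2 < \<beta>\<close> by (simp add: zero_less_mult_iff)
  ultimately show ?thesis by simp
qed

end
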